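(* Let $n\in\mathbb{N}$, let $\operatorname{Tr}$ be the canonical trace on $M_n$, and let $f\colon[0,\infty)\to\mathbb{R}$ be an $(n+1)$-concave function with $f(0)\ge 0$ and $f((0,\infty))\subset(0,\infty)$. Define $g\colon[0,\infty)\to\mathbb{R}$ by $g(t)=\dfrac{t}{f(t)}$ for $t\in(0,\infty)$ and $g(0)=0$. Then for any pair of positive semi-definite matrices $A,B\in M_n$, $$\operatorname{Tr}(A)+\operatorname{Tr}(B)-\operatorname{Tr}(|A-B|)\le 2\operatorname{Tr}\bigl(f(A)^{1/2}g(B)f(A)^{1/2}\bigr).$$
   Context: $M_m$ is the algebra of all $m\times m$ complex matrices; inequalities between self-adjoint matrices refer to the order $X\le Y$ iff $Y-X$ is positive semi-definite; functions of self-adjoint matrices are defined by functional calculus, and $|X|=(X^*X)^{1/2}$. The canonical trace is the usual (unnormalized) matrix trace. A function $f\colon[0,\infty)\to\mathbb{R}$ is $m$-concave if $f(\lambda A+(1-\lambda)B)\ge\lambda f(A)+(1-\lambda)f(B)$ for all $\lambda\in[0,1]$ and all positive semi-definite $A,B\in M_m$. *)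

theory Defs
  imports "Jordan_Normal_Form.Schur_Decomposition"
begin

definition mat_trace :: "complex mat \<Rightarrow> complex" where
  "mat_trace A = (\<Sum>i<dim_row A. A $$ (i, i))"

definition unitary_mat :: "nat \<Rightarrow> complex mat \<Rightarrow> bool" where
  "unitary_mat n U \<longleftrightarrow> U \<in> carrier_mat n n \<and> mat_adjoint U * U = 1\<^sub>m n \<and> U * mat_adjoint U = 1\<^sub>m n"

text \<open>The order on complex numbers used here is the one of \<^theory>\<open>HOL-Library.Complex_Order\<close>:
  \<open>0 \<le> z\<close> means that \<open>z\<close> is real and nonnegative.\<close>

definition psd_mat :: "nat \<Rightarrow> complex mat \<Rightarrow> bool" where
  "psd_mat n A \<longleftrightarrow> A \<in> carrier_mat n n \<and> mat_adjoint A = A \<and>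
     (\<forall>v \<in> carrier_vec n. 0 \<le> (A *\<^sub>v v) \<bullet>c v)"

text \<open>The library instance of \<open>\<le>\<close> on type \<^typ>\<open>'a mat\<close> is entrywise, so the order
  of self-adjoint matrices gets its own name.\<close>

definition loewner_le :: "nat \<Rightarrow> complex mat \<Rightarrow> complex mat \<Rightarrow> bool" where
  "loewner_le n X Y \<longleftrightarrow> psd_mat n (Y - X)"

text \<open>Functional calculus of a self-adjoint matrix: if \<open>A = U diag(d) U\<^sup>*\<close> with
  \<open>U\<close> unitary and \<open>d\<close> real, then \<open>f(A) = U diag(f \<circ> d) U\<^sup>*\<close>. Lemma \<open>mat_fun_unitary_diag\<close>
  below shows that the result does not depend on the diagonalization. Only the values of \<open>f\<close>
  on the spectrum of \<open>A\<close> matter.\<close>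

definition unitary_diag :: "nat \<Rightarrow> complex mat \<Rightarrow> (nat \<Rightarrow> real) \<Rightarrow> complex mat" where
  "unitary_diag n U d = U * mat_diag n (\<lambda>i. complex_of_real (d i)) * mat_adjoint U"

definition mat_fun :: "(real \<Rightarrow> real) \<Rightarrow> complex mat \<Rightarrow> complex mat" where
  "mat_fun f A = (THE X. \<exists>U d. unitary_mat (dim_row A) U \<and> A = unitary_diag (dim_row A) U d \<and>
     X = unitary_diag (dim_row A) U (f \<circ> d))"

definition mat_sqrt :: "complex mat \<Rightarrow> complex mat" where
  "mat_sqrt A = mat_fun sqrt A"

definition mat_abs :: "complex mat \<Rightarrow> complex mat" where
  "mat_abs X = mat_sqrt (mat_adjoint X * X)"

text \<open>A function on \<open>[0,\<infinity>)\<close> is represented by a function on the reals whose values at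
  negative arguments are irrelevant.\<close>

definition matrix_concave :: "nat \<Rightarrow> (real \<Rightarrow> real) \<Rightarrow> bool" where
  "matrix_concave m f \<longleftrightarrow>
     (\<forall>l::real. 0 \<le> l \<and> l \<le> 1 \<longrightarrow> (\<forall>A B. psd_mat m A \<and> psd_mat m B \<longrightarrow>
        loewner_le m
          (complex_of_real l \<cdot>\<^sub>m mat_fun f A + complex_of_real (1 - l) \<cdot>\<^sub>m mat_fun f B)
          (mat_fun f (complex_of_real l \<cdot>\<^sub>m A + complex_of_real (1 - l) \<cdot>\<^sub>m B))))"

lemma mat_adjoint_carrier: "A \<in> carrier_mat n m \<Longrightarrow> mat_adjoint A \<in> carrier_mat m n"
  unfolding mat_adjoint_def by auto

lemma unitary_diag_carrier: "unitary_mat n U \<Longrightarrow> unitary_diag n U d \<in> carrier_mat n n"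
  unfolding unitary_diag_def unitary_mat_def
  by (auto intro!: mult_carrier_mat mat_adjoint_carrier)

lemma unitary_diag_cong:
  assumes U: "unitary_mat n U" and V: "unitary_mat n V"
    and eq: "unitary_diag n U d = unitary_diag n V e"
  shows "unitary_diag n U (f \<circ> d) = unitary_diag n V (f \<circ> e)"
proof -
  define U' V' where "U' = mat_adjoint U" and "V' = mat_adjoint V"
  have c: "U \<in> carrier_mat n n" "V \<in> carrier_mat n n" "U' \<in> carrier_mat n n" "V' \<in> carrier_mat n n"
    using U V unfolding unitary_mat_def U'_def V'_def by (auto intro: mat_adjoint_carrier)
  have u: "U' * U = 1\<^sub>m n" "U * U' = 1\<^sub>m n" "V' * V = 1\<^sub>m n" "V * V' = 1\<^sub>m n"
    using U V unfolding unitary_mat_def U'_def V'_def by auto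
  define D where "D = (\<lambda>d :: nat \<Rightarrow> real. mat_diag n (\<lambda>i. complex_of_real (d i)))"
  have Dc: "D d \<in> carrier_mat n n" for d by (simp add: D_def)
  have cross: "(V' * U) * D d' = D e' * (V' * U) \<longleftrightarrow> U * D d' * U' = V * D e' * V'" for d' e'
  proof
    assume h: "(V' * U) * D d' = D e' * (V' * U)"
    have "U * D d' * U' = (V * V') * (U * D d' * U')"
      using c Dc u by (simp add: mult_carrier_mat[of _ n n])
    also have "\<dots> = V * ((V' * U) * D d') * U'"
      using c Dc by (simp add: assoc_mult_mat[of _ n n _ n _ n] mult_carrier_mat[of _ n n])
    also have "\<dots> = V * (D e' * (V' * U)) * U'" using h by simp
    also have "\<dots> = V * D e' * V' * (U * U')"
      using c Dc by (simp add: assoc_mult_mat[of _ n n _ n _ n] mult_carrier_mat[of _ n n])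
    also have "\<dots> = V * D e' * V'"
      using c Dc u by (simp add: mult_carrier_mat[of _ n n])
    finally show "U * D d' * U' = V * D e' * V'" .
  next
    assume h: "U * D d' * U' = V * D e' * V'"
    have "V' * U * D d' \<in> carrier_mat n n"
      using c Dc by (meson mult_carrier_mat)
    then have "(V' * U) * D d' = (V' * U) * D d' * (U' * U)"
      using u by (simp add: right_mult_one_mat[of _ n n])
    also have "\<dots> = V' * (U * D d' * U') * U"
      using c Dc by (simp add: assoc_mult_mat[of _ n n _ n _ n] mult_carrier_mat[of _ n n])
    also have "\<dots> = V' * (V * D e' * V') * U" using h by simp
    also have "\<dots> = (V' * V) * (D e' * (V' * U))"
      using c Dc by (simp add: assoc_mult_mat[of _ n n _ n _ n] mult_carrier_mat[of _ n n])
    also have "\<dots> = D e' * (V' * U)"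
      unfolding u using c Dc by (meson left_mult_one_mat mult_carrier_mat)
    finally show "(V' * U) * D d' = D e' * (V' * U)" .
  qed
  define W where "W = V' * U"
  have W: "W \<in> carrier_mat n n" using c unfolding W_def by auto
  have entry: "W * D d' = D e' * W \<longleftrightarrow>
      (\<forall>i<n. \<forall>j<n. W $$ (i, j) * complex_of_real (d' j) = complex_of_real (e' i) * W $$ (i, j))" for d' e'
    unfolding D_def mat_diag_mult_left[OF W] mat_diag_mult_right[OF W]
    by (auto simp: mat_eq_iff)
  have "W * D d = D e * W"
    using eq cross[of d e] unfolding unitary_diag_def D_def U'_def V'_def W_def by simp
  then have E: "\<forall>i<n. \<forall>j<n. W $$ (i, j) * complex_of_real (d j) = complex_of_real (e i) * W $$ (i, j)"
    by (simp only: entry)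
  have "W * D (f \<circ> d) = D (f \<circ> e) * W"
    unfolding entry
  proof (intro allI impI)
    fix i j assume "i < n" "j < n"
    then have "W $$ (i, j) = 0 \<or> d j = e i" using E by auto
    then show "W $$ (i, j) * complex_of_real ((f \<circ> d) j) = complex_of_real ((f \<circ> e) i) * W $$ (i, j)"
      by auto
  qed
  then show ?thesis
    using cross[of "f \<circ> d" "f \<circ> e"] unfolding unitary_diag_def D_def U'_def V'_def W_def by simp
qed

lemma mat_fun_unitary_diag:
  assumes U: "unitary_mat n U"
  shows "mat_fun f (unitary_diag n U d) = unitary_diag n U (f \<circ> d)"
proof -
  have n: "dim_row (unitary_diag n U d) = n" using unitary_diag_carrier[OF U] by auto
  show ?thesis unfolding mat_fun_def n
    by (rule the_equality) (use U in blast, use U unitary_diag_cong[of n U _ d _ f] in metis)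
qed

end

theory Submission
  imports Defs "Jordan_Normal_Form.Spectral_Radius"
begin

text \<open>The proof is the standard one for generalized Powers--Stormer inequalities. Let \<open>Q\<close> be the
negative part of \<open>A - B\<close> and \<open>C = A + Q\<close>, so that \<open>C\<close> dominates both \<open>A\<close> and \<open>B\<close> and
\<open>2 Tr C = Tr A + Tr B + Tr |A - B|\<close>. If \<open>f\<close> and \<open>g\<close> are both monotone on positive semi-definite
\<open>n \<times> n\<close> matrices, then the three products
\<open>f(A) (g(C) - g(A))\<close>, \<open>(f(C) - f(A)) (g(C) - g(B))\<close> and \<open>(f(C) - f(B)) g(B)\<close> have nonnegative trace,
and since \<open>Tr f(X) g(X) = Tr X\<close>, their sum telescopes to
\<open>Tr f(A) g(B) - (Tr A + Tr B - Tr C)\<close>. What has to be shown is therefore that concavity makes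
\<open>f\<close> and \<open>g\<close> monotone.

For \<open>f\<close> (lemma \<open>mat_fun_mono\<close>): if \<open>A \<le> C\<close> and \<open>l < 1\<close>, then \<open>C\<close> is a convex combination
\<open>l A + (1 - l) D\<close> with \<open>D \<ge> 0\<close>, so \<open>f(C) \<ge> l f(A)\<close>; let \<open>l\<close> tend to \<open>1\<close>.

For \<open>g\<close> (lemma \<open>mat_fun_quotient_mono\<close>) the increment \<open>C - A\<close> is added in rank one steps, and this is
why a single additional dimension suffices. Let \<open>B = A + v v\<^sup>*\<close> and let \<open>T\<close> be the
\<open>n \<times> (n + 1)\<close> matrix whose columns are \<open>v\<close> and those of \<open>A\<^sup>1\<^sup>/\<^sup>2\<close>. Then \<open>T T\<^sup>* = B\<close>, while \<open>Y = T\<^sup>* T\<close>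
has \<open>A\<close> as its compression to the last \<open>n\<close> coordinates. Averaging \<open>Y\<close> with its conjugate by a
reflection kills the off-diagonal blocks, so concavity in dimension \<open>n + 1\<close> says that \<open>f(A)\<close>
dominates the compression of \<open>f(Y)\<close>. With \<open>h(t) = f(t) / t\<close>, the compression of \<open>T\<^sup>* h(B) T\<close> is
\<open>A\<^sup>1\<^sup>/\<^sup>2 h(B) A\<^sup>1\<^sup>/\<^sup>2\<close>, and \<open>f(Y) \<ge> T\<^sup>* h(B) T\<close>. The resulting inequality
\<open>f(A) \<ge> A\<^sup>1\<^sup>/\<^sup>2 h(B) A\<^sup>1\<^sup>/\<^sup>2\<close> (lemma \<open>mat_fun_rank_one_compression\<close>) turns into \<open>g(A) \<ge> g(A) h(B) g(A)\<close>,
and since \<open>g(B)\<close> is the pseudo-inverse of \<open>h(B)\<close>, completing the square gives \<open>g(B) \<ge> g(A)\<close>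
(lemma \<open>mat_fun_rank_one_mono\<close>).\<close>

section \<open>Matrix algebra with adjoints\<close>

lemma mat_adjoint_dim [simp]:
  "dim_row (mat_adjoint A) = dim_col A" "dim_col (mat_adjoint A) = dim_row A"
  unfolding mat_adjoint_def by auto

lemma mat_adjoint_index [simp]:
  "i < dim_col A \<Longrightarrow> j < dim_row A \<Longrightarrow> mat_adjoint (A :: complex mat) $$ (i, j) = cnj (A $$ (j, i))"
  unfolding mat_adjoint_def by (simp add: mat_of_rows_def)

lemma mat_adjoint_adjoint [simp]: "mat_adjoint (mat_adjoint A) = (A :: complex mat)"
  by (rule eq_matI) auto

lemma mat_adjoint_mult:
  "dim_col A = dim_row B \<Longrightarrow> mat_adjoint (A * B) = mat_adjoint B * mat_adjoint (A :: complex mat)"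
  by (rule eq_matI) (auto simp: scalar_prod_def cnj_sum mult.commute)

lemma mat_adjoint_add:
  "dim_row A = dim_row B \<Longrightarrow> dim_col A = dim_col B \<Longrightarrow>
    mat_adjoint (A + B) = mat_adjoint A + mat_adjoint (B :: complex mat)"
  by (rule eq_matI) auto

lemma mat_adjoint_minus:
  "dim_row A = dim_row B \<Longrightarrow> dim_col A = dim_col B \<Longrightarrow>
    mat_adjoint (A - B) = mat_adjoint A - mat_adjoint (B :: complex mat)"
  by (rule eq_matI) auto

lemma mat_adjoint_smult: "mat_adjoint (c \<cdot>\<^sub>m A) = cnj c \<cdot>\<^sub>m mat_adjoint (A :: complex mat)"
  by (rule eq_matI) auto

lemma mat_adjoint_one [simp]: "mat_adjoint (1\<^sub>m n) = (1\<^sub>m n :: complex mat)"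
  by (rule eq_matI) auto

text \<open>The algebraic laws are stated with equations between dimensions as premises, not with carrier sets:
the simplifier can then discharge the premises by computing dimensions, also for rectangular factors.\<close>

lemma mat_assoc:
  "dim_col A = dim_row B \<Longrightarrow> dim_col B = dim_row C \<Longrightarrow> A * B * C = A * (B * (C :: 'a :: semiring_0 mat))"
  by (rule assoc_mult_mat[of _ "dim_row A" "dim_col A" _ "dim_col B" _ "dim_col C"]) auto

text \<open>Products are normalized to the right, so a rule \<open>A * B = C\<close> has to be able to fire inside
\<open>A * (B * X)\<close> as well; this form provides the second rewrite rule.\<close>

lemma mat_assoc_eq:
  assumes "A * B = C" "dim_col A = dim_row B" "dim_col B = dim_row (X :: 'a :: semiring_0 mat)"
  shows "A * (B * X) = C * X"
  using assms by (metis mat_assoc)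

lemma mat_distrib_left:
  "dim_col A = dim_row B \<Longrightarrow> dim_row B = dim_row C \<Longrightarrow> dim_col B = dim_col C \<Longrightarrow>
    A * (B + C) = A * B + A * (C :: complex mat)"
  by (rule mult_add_distrib_mat[of _ "dim_row A" "dim_col A" _ "dim_col B"]) auto

lemma mat_distrib_right:
  "dim_col B = dim_row A \<Longrightarrow> dim_row B = dim_row C \<Longrightarrow> dim_col B = dim_col C \<Longrightarrow>
    (B + C) * A = B * A + C * (A :: complex mat)"
  by (rule add_mult_distrib_mat[of _ "dim_row B" "dim_col B" _ _ "dim_col A"]) auto

lemma mat_diff_left:
  "dim_col A = dim_row B \<Longrightarrow> dim_row B = dim_row C \<Longrightarrow> dim_col B = dim_col C \<Longrightarrow>
    A * (B - C) = A * B - A * (C :: complex mat)"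
  by (rule mult_minus_distrib_mat[of _ "dim_row A" "dim_col A" _ "dim_col B"]) auto

lemma mat_diff_right:
  "dim_col B = dim_row A \<Longrightarrow> dim_row B = dim_row C \<Longrightarrow> dim_col B = dim_col C \<Longrightarrow>
    (B - C) * A = B * A - C * (A :: complex mat)"
  by (rule minus_mult_distrib_mat[of _ "dim_row B" "dim_col B" _ _ "dim_col A"]) auto

lemma mat_smult_left: "dim_col A = dim_row B \<Longrightarrow> (c \<cdot>\<^sub>m A) * B = c \<cdot>\<^sub>m (A * (B :: complex mat))"
  by (rule mult_smult_assoc_mat[of _ "dim_row A" "dim_col A" _ "dim_col B"]) auto

lemma mat_smult_right: "dim_col A = dim_row B \<Longrightarrow> A * (c \<cdot>\<^sub>m B) = c \<cdot>\<^sub>m (A * (B :: complex mat))"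
  by (rule mult_smult_distrib[of _ "dim_row A" "dim_col A" _ "dim_col B"]) auto

lemma mat_add_zero [simp]:
  "dim_row A = n \<Longrightarrow> dim_col A = m \<Longrightarrow> A + 0\<^sub>m n m = (A :: complex mat)"
  "dim_row A = n \<Longrightarrow> dim_col A = m \<Longrightarrow> 0\<^sub>m n m + A = (A :: complex mat)"
  by auto

lemmas mat_algebra = mat_assoc mat_distrib_left mat_distrib_right mat_diff_left mat_diff_right
  mat_smult_left mat_smult_right mat_adjoint_mult mat_adjoint_add mat_adjoint_minus mat_adjoint_smult

section \<open>Positive semi-definite matrices\<close>

lemma cscalar_prod_adjoint:
  assumes "M \<in> carrier_mat n m" "w \<in> carrier_vec n" "v \<in> carrier_vec m"
  shows "(mat_adjoint M *\<^sub>v w) \<bullet>c v = w \<bullet>c (M *\<^sub>v v :: complex vec)"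
proof -
  have "(mat_adjoint M *\<^sub>v w) \<bullet>c v = (\<Sum>i<m. \<Sum>k<n. cnj (M $$ (k, i)) * w $ k * cnj (v $ i))"
    using assms by (simp add: scalar_prod_def sum_distrib_right atLeast0LessThan)
  also have "\<dots> = (\<Sum>k<n. \<Sum>i<m. cnj (M $$ (k, i)) * w $ k * cnj (v $ i))"
    by (rule sum.swap)
  also have "\<dots> = w \<bullet>c (M *\<^sub>v v)"
    using assms by (simp add: scalar_prod_def sum_distrib_left atLeast0LessThan cnj_sum algebra_simps)
  finally show ?thesis .
qed

lemma psd_mat_dim: "psd_mat n A \<Longrightarrow> dim_row A = n" "psd_mat n A \<Longrightarrow> dim_col A = n"
  unfolding psd_mat_def by auto

lemma psd_congruence:
  assumes A: "psd_mat n A" and Z: "Z \<in> carrier_mat n m"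
  shows "psd_mat m (mat_adjoint Z * A * Z)"
proof -
  have c: "A \<in> carrier_mat n n" "mat_adjoint A = A" and q: "\<And>v. v \<in> carrier_vec n \<Longrightarrow> 0 \<le> (A *\<^sub>v v) \<bullet>c v"
    using A by (auto simp: psd_mat_def)
  have "0 \<le> (mat_adjoint Z * A * Z *\<^sub>v v) \<bullet>c v" if v: "v \<in> carrier_vec m" for v
  proof -
    have "mat_adjoint Z * A * Z *\<^sub>v v = mat_adjoint Z *\<^sub>v (A *\<^sub>v (Z *\<^sub>v v))"
      using c Z v by (simp add: assoc_mult_mat_vec[of _ m n _ n] assoc_mult_mat_vec[of _ m n _ m]
          assoc_mult_mat_vec[of _ n n _ m] mat_adjoint_carrier mult_carrier_mat[of _ m n])
    then have "(mat_adjoint Z * A * Z *\<^sub>v v) \<bullet>c v = (A *\<^sub>v (Z *\<^sub>v v)) \<bullet>c (Z *\<^sub>v v)"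
      using cscalar_prod_adjoint[OF Z _ v] c Z v by simp
    then show ?thesis using q[of "Z *\<^sub>v v"] Z v by simp
  qed
  then show ?thesis using c Z unfolding psd_mat_def
    by (auto simp: mat_algebra mat_adjoint_carrier)
qed

lemma psd_one: "psd_mat n (1\<^sub>m n)"
  unfolding psd_mat_def by (auto intro: conjugate_square_ge_0_vec)

lemma psd_adjoint_mult_self: "M \<in> carrier_mat n m \<Longrightarrow> psd_mat m (mat_adjoint M * M)"
  using psd_congruence[OF psd_one, of M n m] by (simp add: mat_algebra)

lemma psd_add: "psd_mat n A \<Longrightarrow> psd_mat n B \<Longrightarrow> psd_mat n (A + B)"
  unfolding psd_mat_def
  by (auto simp: mat_algebra add_mult_distrib_mat_vec[of _ n n] add_scalar_prod_distrib[of _ n]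
      intro: add_nonneg_nonneg)

lemma smult_mat_mult_vec: "dim_col A = dim_vec v \<Longrightarrow> (c \<cdot>\<^sub>m A) *\<^sub>v v = c \<cdot>\<^sub>v (A *\<^sub>v (v :: complex vec))"
  by (rule eq_vecI) (auto simp: scalar_prod_def sum_distrib_left mult.assoc)

lemma psd_smult: "psd_mat n A \<Longrightarrow> 0 \<le> c \<Longrightarrow> psd_mat n (complex_of_real c \<cdot>\<^sub>m A)"
  unfolding psd_mat_def
  by (auto simp: mat_algebra smult_mat_mult_vec less_eq_complex_def)

lemma psd_diag_nonneg:
  assumes "psd_mat n A" "i < n"
  shows "0 \<le> A $$ (i, i)"
proof -
  have "0 \<le> (A *\<^sub>v unit_vec n i) \<bullet>c unit_vec n i"
    using assms by (simp add: psd_mat_def)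
  also have "(A *\<^sub>v unit_vec n i) \<bullet>c unit_vec n i = A $$ (i, i)"
  proof -
    have "A \<in> carrier_mat n n" using assms by (simp add: psd_mat_def)
    moreover have "conjugate (unit_vec n i) = (unit_vec n i :: complex vec)"
      by (rule eq_vecI) (auto simp: unit_vec_def)
    ultimately show ?thesis using assms(2) by simp
  qed
  finally show ?thesis .
qed

text \<open>The diagonal entries of \<open>M\<^sup>* M\<close> are the squared norms of the columns of \<open>M\<close>.\<close>

lemma adjoint_mult_self_eq_0:
  fixes M :: "complex mat"
  assumes M: "M \<in> carrier_mat n m" and z: "\<And>i. i < m \<Longrightarrow> (mat_adjoint M * M) $$ (i, i) = 0"
  shows "M = 0\<^sub>m n m"
proof (rule eq_matI)
  fix k i assume "k < dim_row (0\<^sub>m n m :: complex mat)" "i < dim_col (0\<^sub>m n m :: complex mat)"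
  then have ki: "k < n" "i < m" by auto
  have "(mat_adjoint M * M) $$ (i, i) = (\<Sum>j<n. cnj (M $$ (j, i)) * M $$ (j, i))"
    using M ki by (simp add: scalar_prod_def atLeast0LessThan)
  also have "\<dots> = complex_of_real (\<Sum>j<n. (cmod (M $$ (j, i)))\<^sup>2)"
    by (simp add: complex_norm_square mult.commute del: of_real_power)
  finally have "(\<Sum>j<n. (cmod (M $$ (j, i)))\<^sup>2) = 0"
    using z[OF ki(2)] by (metis of_real_eq_0_iff)
  then have "(cmod (M $$ (k, i)))\<^sup>2 = 0"
    using ki by (subst (asm) sum_nonneg_eq_0_iff) auto
  then show "M $$ (k, i) = 0\<^sub>m n m $$ (k, i)" using ki by simp
qed (use M in auto)

section \<open>Splitting off one coordinate\<close>

text \<open>The isometries of \<open>\<complex>\<^sup>n\<close> and \<open>\<complex>\<close> onto the last \<open>n\<close> coordinates and onto the first coordinate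
of \<open>\<complex>\<^sup>n\<^sup>+\<^sup>1\<close>. Written with them, block matrices become sums of products, and identities between blocks
follow from the few relations below.\<close>

definition tail_incl :: "nat \<Rightarrow> complex mat" where
  "tail_incl n = mat (Suc n) n (\<lambda>(i, j). if i = Suc j then 1 else 0)"

definition head_incl :: "nat \<Rightarrow> complex mat" where
  "head_incl n = mat (Suc n) 1 (\<lambda>(i, j). if i = 0 then 1 else 0)"

lemma incl_dim [simp]:
  "dim_row (tail_incl n) = Suc n" "dim_col (tail_incl n) = n"
  "dim_row (head_incl n) = Suc n" "dim_col (head_incl n) = 1"
  by (simp_all add: tail_incl_def head_incl_def)

lemma incl_isometry [simp]:
  "mat_adjoint (tail_incl n) * tail_incl n = 1\<^sub>m n"
  "mat_adjoint (head_incl n) * head_incl n = 1\<^sub>m 1"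
  "mat_adjoint (tail_incl n) * head_incl n = 0\<^sub>m n 1"
  "mat_adjoint (head_incl n) * tail_incl n = 0\<^sub>m 1 n"
  by (rule eq_matI; auto simp: scalar_prod_def tail_incl_def head_incl_def sum.delta
      if_distrib[of cnj] if_distrib[of "\<lambda>x. x * _"] cong: if_cong)+

lemma incl_complete:
  "tail_incl n * mat_adjoint (tail_incl n) + head_incl n * mat_adjoint (head_incl n) = 1\<^sub>m (Suc n)"
proof (rule eq_matI)
  fix i j assume "i < dim_row (1\<^sub>m (Suc n) :: complex mat)" "j < dim_col (1\<^sub>m (Suc n) :: complex mat)"
  then show "(tail_incl n * mat_adjoint (tail_incl n) + head_incl n * mat_adjoint (head_incl n)) $$ (i, j)
      = 1\<^sub>m (Suc n) $$ (i, j)"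
    by (cases i; cases j) (auto simp: scalar_prod_def tail_incl_def head_incl_def sum.delta sum.delta'
        if_distrib[of cnj] if_distrib[of "\<lambda>x. x * _"] if_distrib[of "\<lambda>x. _ * x"] cong: if_cong)
qed simp_all

section \<open>The spectral theorem for Hermitian matrices\<close>

lemma unitary_mat_dim: "unitary_mat n U \<Longrightarrow> dim_row U = n" "unitary_mat n U \<Longrightarrow> dim_col U = n"
  by (auto simp: unitary_mat_def)

lemma unitary_mat_mult:
  assumes "unitary_mat n U" "unitary_mat n V"
  shows "unitary_mat n (U * V)"
proof -
  note [simp] = assms[THEN unitary_mat_dim(1)] assms[THEN unitary_mat_dim(2)]
  have *: "mat_adjoint U * U = 1\<^sub>m n" "U * mat_adjoint U = 1\<^sub>m n"
     "mat_adjoint V * V = 1\<^sub>m n" "V * mat_adjoint V = 1\<^sub>m n"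
    using assms by (auto simp: unitary_mat_def)
  show ?thesis unfolding unitary_mat_def
    using * by (auto simp: mat_algebra *[THEN mat_assoc_eq] intro: carrier_matI)
qed

text \<open>Complete \<open>v\<close> to a basis, orthogonalize, and normalize the columns; Gram-Schmidt leaves the
first vector alone.\<close>

lemma ex_unitary_first_column:
  assumes v: "v \<in> carrier_vec (Suc n)" "v \<noteq> 0\<^sub>v (Suc n)"
  shows "\<exists>W c. unitary_mat (Suc n) W \<and> col W 0 = c \<cdot>\<^sub>v v"
proof -
  let ?n = "Suc n"
  interpret cof_vec_space ?n "TYPE(complex)" .
  define ws where "ws = gram_schmidt ?n (basis_completion v)"
  note bc = basis_completion[OF v]
  obtain vs where vs: "basis_completion v = v # vs"
    using bc(6,7) by (cases "basis_completion v") auto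
  have hd: "hd ws = v" using v(1) by (simp add: ws_def vs)
  note gs = gram_schmidt_result[OF bc(2,4,5) ws_def]
  have len: "length ws = ?n" using gs(4) bc(6) by simp
  have wc: "ws ! j \<in> carrier_vec ?n" if "j < ?n" for j using gs(3) len that by auto
  have w0: "ws ! 0 = v" using hd len by (metis hd_conv_nth list.size(3) nat.simps(3))
  define r where "r = (\<lambda>j. sqrt (Re (ws ! j \<bullet>c ws ! j)))"
  have orth: "ws ! i \<bullet>c ws ! j = (if i = j then complex_of_real ((r i)\<^sup>2) else 0)"
    and rpos: "r i \<noteq> 0" if "i < ?n" "j < ?n" for i j
  proof -
    have ge: "0 \<le> ws ! i \<bullet>c ws ! i" by (rule conjugate_square_ge_0_vec)
    have z: "(ws ! i \<bullet>c ws ! j = 0) = (i \<noteq> j)" "(ws ! i \<bullet>c ws ! i = 0) = (i \<noteq> i)"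
      using corthogonalD[OF gs(2)] that len by auto
    have "0 < Re (ws ! i \<bullet>c ws ! i)"
      using ge z(2) by (auto simp: less_eq_complex_def complex_eq_iff)
    then show "r i \<noteq> 0" "ws ! i \<bullet>c ws ! j = (if i = j then complex_of_real ((r i)\<^sup>2) else 0)"
      using z(1) ge by (auto simp: r_def less_eq_complex_def complex_eq_iff)
  qed
  define W where "W = mat ?n ?n (\<lambda>(i, j). ws ! j $ i / complex_of_real (r j))"
  have Wc: "W \<in> carrier_mat ?n ?n" by (simp add: W_def)
  have "mat_adjoint W * W = 1\<^sub>m ?n"
  proof (rule eq_matI)
    fix i j assume "i < dim_row (1\<^sub>m ?n :: complex mat)" "j < dim_col (1\<^sub>m ?n :: complex mat)"
    then have ij: "i < ?n" "j < ?n" by auto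
    have "(mat_adjoint W * W) $$ (i, j)
        = (\<Sum>k<?n. cnj (ws ! i $ k / complex_of_real (r i)) * (ws ! j $ k / complex_of_real (r j)))"
      using ij Wc by (simp add: scalar_prod_def atLeast0LessThan W_def)
    also have "\<dots> = (\<Sum>k<?n. ws ! j $ k * cnj (ws ! i $ k)) / (complex_of_real (r i) * complex_of_real (r j))"
      by (simp add: sum_divide_distrib mult.commute del: sum.lessThan_Suc)
    also have "(\<Sum>k<?n. ws ! j $ k * cnj (ws ! i $ k)) = ws ! j \<bullet>c ws ! i"
      using wc[OF ij(1)] wc[OF ij(2)] by (simp add: scalar_prod_def atLeast0LessThan)
    finally show "(mat_adjoint W * W) $$ (i, j) = 1\<^sub>m ?n $$ (i, j)"
      using ij orth[OF ij(2) ij(1)] rpos[OF ij(1) ij(1)] by (auto simp: power2_eq_square)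
  qed (use Wc in auto)
  moreover from this have "W * mat_adjoint W = 1\<^sub>m ?n"
    by (rule mat_mult_left_right_inverse[OF mat_adjoint_carrier[OF Wc] Wc])
  moreover have "col W 0 = (1 / complex_of_real (r 0)) \<cdot>\<^sub>v v"
    by (rule eq_vecI) (use v in \<open>auto simp: W_def w0\<close>)
  ultimately show ?thesis unfolding unitary_mat_def using Wc by blast
qed

lemma mat_diag_carrier_dim [simp]: "dim_row (mat_diag n f) = n" "dim_col (mat_diag n f) = n"
  by (simp_all add: mat_diag_def)

text \<open>Induction on the dimension. Conjugating by a unitary whose first column is an eigenvector makes the first
coordinate vector \<open>e\<close> an eigenvector; by self-adjointness the eigenvalue is real and the
complement of \<open>e\<close> is invariant, so the induction hypothesis applies to the compression to it.\<close>

theorem hermitian_spectral: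
  assumes "A \<in> carrier_mat n n" "mat_adjoint A = A"
  shows "\<exists>U d. unitary_mat n U \<and> A = unitary_diag n U d"
  using assms
proof (induction n arbitrary: A)
  case 0
  then show ?case
    by (intro exI[of _ "1\<^sub>m 0"] exI[of _ "\<lambda>_. 0"])
       (auto simp: unitary_mat_def unitary_diag_def intro!: eq_matI)
next
  case (Suc n)
  note [simp] = carrier_matD[OF Suc.prems(1)]
  obtain l where l: "eigenvalue A l"
    using Suc.prems(1) spectrum_non_empty[of A "Suc n"] by (auto simp: spectrum_def)
  then obtain v where v: "v \<in> carrier_vec (Suc n)" "v \<noteq> 0\<^sub>v (Suc n)" "A *\<^sub>v v = l \<cdot>\<^sub>v v"
    by (auto simp: eigenvalue_def eigenvector_def)
  obtain W c where W: "unitary_mat (Suc n) W" and col: "col W 0 = c \<cdot>\<^sub>v v"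
    using ex_unitary_first_column[OF v(1,2)] by blast
  note [simp] = unitary_mat_dim[OF W]
  have WW: "mat_adjoint W * W = 1\<^sub>m (Suc n)" "W * mat_adjoint W = 1\<^sub>m (Suc n)"
    using W by (auto simp: unitary_mat_def)
  define E e where "E = tail_incl n" and "e = head_incl n"
  have Ed [simp]: "dim_row E = Suc n" "dim_col E = n" "dim_row e = Suc n" "dim_col e = 1"
    by (simp_all add: E_def e_def)
  note iso = incl_isometry[of n, folded E_def e_def]
  note isoc = iso[THEN mat_assoc_eq]
  have compl: "E * mat_adjoint E + e * mat_adjoint e = 1\<^sub>m (Suc n)"
    using incl_complete by (simp add: E_def e_def)
  define v' where "v' = mat (Suc n) 1 (\<lambda>(i, _). v $ i)"
  have We: "W * e = c \<cdot>\<^sub>m v'"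
  proof (rule eq_matI)
    fix i j assume "i < dim_row (c \<cdot>\<^sub>m v')" "j < dim_col (c \<cdot>\<^sub>m v')"
    then have ij: "i < Suc n" "j = 0" by (auto simp: v'_def)
    have "(W * e) $$ (i, j) = W $$ (i, 0)"
      using ij by (simp add: scalar_prod_def e_def head_incl_def sum.delta
          if_distrib[of "\<lambda>x. _ * x"] cong: if_cong)
    also have "\<dots> = col W 0 $ i" using ij by simp
    finally show "(W * e) $$ (i, j) = (c \<cdot>\<^sub>m v') $$ (i, j)"
      using ij v(1) by (simp add: col v'_def)
  qed (auto simp: v'_def)
  have Av: "A * v' = l \<cdot>\<^sub>m v'"
  proof (rule eq_matI)
    fix i j assume "i < dim_row (l \<cdot>\<^sub>m v')" "j < dim_col (l \<cdot>\<^sub>m v')"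
    then have ij: "i < Suc n" "j = 0" by (auto simp: v'_def)
    have "(A * v') $$ (i, j) = (A *\<^sub>v v) $ i"
      using ij v(1) by (simp add: scalar_prod_def v'_def)
    then show "(A * v') $$ (i, j) = (l \<cdot>\<^sub>m v') $$ (i, j)"
      using ij v(1) by (simp add: v(3) v'_def)
  qed (auto simp: v'_def)
  have [simp]: "dim_row v' = Suc n" "dim_col v' = 1" by (simp_all add: v'_def)
  define M where "M = mat_adjoint W * A * W"
  have Md [simp]: "dim_row M = Suc n" "dim_col M = Suc n" by (simp_all add: M_def)
  have Mh: "mat_adjoint M = M" by (simp add: M_def mat_algebra Suc.prems)
  have "W * (M * e) = A * (W * e)"
    by (simp add: M_def mat_algebra WW[THEN mat_assoc_eq])
  also have "\<dots> = l \<cdot>\<^sub>m (W * e)"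
    by (simp add: We Av mat_algebra) (auto intro!: eq_matI simp: mult.left_commute)
  finally have "mat_adjoint W * (W * (M * e)) = mat_adjoint W * (l \<cdot>\<^sub>m (W * e))" by simp
  then have Me: "M * e = l \<cdot>\<^sub>m e"
    by (simp add: mat_algebra WW[THEN mat_assoc_eq])
  have eM: "mat_adjoint e * M = cnj l \<cdot>\<^sub>m mat_adjoint e"
    using arg_cong[OF Me, of mat_adjoint] by (simp add: mat_algebra Mh)
  have "mat_adjoint e * (M * e) = l \<cdot>\<^sub>m 1\<^sub>m 1"
    unfolding Me by (simp add: mat_algebra iso)
  moreover have "mat_adjoint e * (M * e) = cnj l \<cdot>\<^sub>m 1\<^sub>m 1"
    by (simp add: eM[THEN mat_assoc_eq] mat_algebra iso)
  ultimately have "(l \<cdot>\<^sub>m 1\<^sub>m 1) $$ (0, 0) = (cnj l \<cdot>\<^sub>m 1\<^sub>m 1) $$ (0, 0)" by simp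
  then have lr: "complex_of_real (Re l) = l" "cnj l = l" by (auto simp: complex_eq_iff)
  define A3 where "A3 = mat_adjoint E * M * E"
  have "A3 \<in> carrier_mat n n" "mat_adjoint A3 = A3"
    by (auto simp: A3_def mat_algebra Mh intro: carrier_matI)
  from Suc.IH[OF this] obtain P d where P: "unitary_mat n P" and A3: "A3 = unitary_diag n P d"
    by blast
  note [simp] = unitary_mat_dim[OF P]
  have PP: "mat_adjoint P * P = 1\<^sub>m n" "P * mat_adjoint P = 1\<^sub>m n"
    using P by (auto simp: unitary_mat_def)
  define D where "D = mat_diag n (\<lambda>i. complex_of_real (d i))"
  have [simp]: "dim_row D = n" "dim_col D = n" by (simp_all add: D_def)
  define U1 where "U1 = E * P * mat_adjoint E + e * mat_adjoint e"
  have [simp]: "dim_row U1 = Suc n" "dim_col U1 = Suc n" by (simp_all add: U1_def)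
  have U1: "unitary_mat (Suc n) U1"
    unfolding unitary_mat_def U1_def
    by (auto simp: mat_algebra isoc PP[THEN mat_assoc_eq] compl intro!: carrier_matI)
  define d' where "d' = (\<lambda>i. case i of 0 \<Rightarrow> Re l | Suc i \<Rightarrow> d i)"
  have d': "mat_diag (Suc n) (\<lambda>i. complex_of_real (d' i)) = E * D * mat_adjoint E + l \<cdot>\<^sub>m (e * mat_adjoint e)"
  proof -
    have 1: "mat_diag (Suc n) (\<lambda>i. complex_of_real (d' i)) * E = E * D"
      unfolding D_def mat_diag_mult_left[of E "Suc n" n, OF carrier_matI[OF Ed(1,2)]]
        mat_diag_mult_right[of E "Suc n" n, OF carrier_matI[OF Ed(1,2)]]
      by (rule eq_matI) (auto simp: E_def tail_incl_def d'_def)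
    have 2: "mat_diag (Suc n) (\<lambda>i. complex_of_real (d' i)) * e = l \<cdot>\<^sub>m e"
      unfolding mat_diag_mult_left[of e "Suc n" 1, OF carrier_matI[OF Ed(3,4)]]
      by (rule eq_matI) (auto simp: e_def head_incl_def d'_def lr)
    have "mat_diag (Suc n) (\<lambda>i. complex_of_real (d' i)) =
      mat_diag (Suc n) (\<lambda>i. complex_of_real (d' i)) * (E * mat_adjoint E + e * mat_adjoint e)"
      unfolding compl by simp
    then show ?thesis
      by (simp add: mat_algebra 1[THEN mat_assoc_eq] 2[THEN mat_assoc_eq])
  qed
  have cross: "mat_adjoint E * (M * e) = 0\<^sub>m n 1"
    unfolding Me by (simp add: mat_algebra iso)
  have "M = (E * mat_adjoint E + e * mat_adjoint e) * M * (E * mat_adjoint E + e * mat_adjoint e)"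
    unfolding compl by simp
  also have "\<dots> = E * A3 * mat_adjoint E + l \<cdot>\<^sub>m (e * mat_adjoint e)"
    by (simp add: mat_algebra A3_def eM eM[THEN mat_assoc_eq] isoc iso lr Me
       cross cross[THEN mat_assoc_eq] Me[THEN mat_assoc_eq])
  also have "\<dots> = U1 * mat_diag (Suc n) (\<lambda>i. complex_of_real (d' i)) * mat_adjoint U1"
    unfolding d' U1_def A3 unitary_diag_def D_def[symmetric]
    by (simp add: mat_algebra isoc iso)
  finally have M: "M = U1 * mat_diag (Suc n) (\<lambda>i. complex_of_real (d' i)) * mat_adjoint U1" .
  have "A = W * M * mat_adjoint W"
    by (simp add: M_def mat_algebra WW[THEN mat_assoc_eq]) (simp add: WW)
  also have "\<dots> = unitary_diag (Suc n) (W * U1) d'"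
    unfolding M unitary_diag_def by (simp add: mat_algebra)
  finally show ?case using unitary_mat_mult[OF W U1] by blast
qed

section \<open>Functional calculus\<close>

definition hermitian_mat :: "nat \<Rightarrow> complex mat \<Rightarrow> bool" where
  "hermitian_mat n A \<longleftrightarrow> A \<in> carrier_mat n n \<and> mat_adjoint A = A"

lemma psd_imp_hermitian: "psd_mat n A \<Longrightarrow> hermitian_mat n A"
  by (auto simp: psd_mat_def hermitian_mat_def)

lemma hermitian_adjoint: "hermitian_mat n A \<Longrightarrow> mat_adjoint A = A"
  by (auto simp: hermitian_mat_def)

lemma hermitian_dim: "hermitian_mat n A \<Longrightarrow> dim_row A = n" "hermitian_mat n A \<Longrightarrow> dim_col A = n"
  by (auto simp: hermitian_mat_def)

lemma hermitian_add: "hermitian_mat n A \<Longrightarrow> hermitian_mat n B \<Longrightarrow> hermitian_mat n (A + B)"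
  by (auto simp: hermitian_mat_def mat_algebra)

lemma hermitian_minus: "hermitian_mat n A \<Longrightarrow> hermitian_mat n B \<Longrightarrow> hermitian_mat n (A - B)"
  using hermitian_dim[of n A] hermitian_dim[of n B] unfolding hermitian_mat_def
  by (simp add: minus_carrier_mat mat_adjoint_minus)

lemma hermitian_smult: "hermitian_mat n A \<Longrightarrow> hermitian_mat n (complex_of_real c \<cdot>\<^sub>m A)"
  by (auto simp: hermitian_mat_def mat_algebra)

lemma hermitian_diagE:
  assumes "hermitian_mat n A"
  obtains U d where "unitary_mat n U" "A = unitary_diag n U d"
  using assms hermitian_spectral unfolding hermitian_mat_def by blast

lemma mat_diag_adjoint [simp]:
  "mat_adjoint (mat_diag n (\<lambda>i. complex_of_real (d i))) = mat_diag n (\<lambda>i. complex_of_real (d i))"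
  by (rule eq_matI) (auto simp: mat_diag_def)

lemma hermitian_unitary_diag: "unitary_mat n U \<Longrightarrow> hermitian_mat n (unitary_diag n U d)"
  using unitary_diag_carrier[of n U d]
  by (auto simp: hermitian_mat_def unitary_diag_def mat_algebra unitary_mat_dim)

lemma unitary_diag_mult:
  assumes U: "unitary_mat n U"
  shows "unitary_diag n U d * unitary_diag n U e = unitary_diag n U (\<lambda>i. d i * e i)"
proof -
  note [simp] = unitary_mat_dim[OF U]
  have u: "mat_adjoint U * U = 1\<^sub>m n" using U by (simp add: unitary_mat_def)
  show ?thesis
    unfolding unitary_diag_def
    by (simp add: mat_algebra u[THEN mat_assoc_eq] mat_diag_diag[THEN mat_assoc_eq])
qed

lemma unitary_diag_add:
  assumes U: "unitary_mat n U"
  shows "unitary_diag n U d + unitary_diag n U e = unitary_diag n U (\<lambda>i. d i + e i)"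
proof -
  note [simp] = unitary_mat_dim[OF U]
  have *: "mat_diag n (\<lambda>i. complex_of_real (d i + e i)) = mat_diag n (\<lambda>i. complex_of_real (d i))
    + mat_diag n (\<lambda>i. complex_of_real (e i))"
    by (rule eq_matI) (auto simp: mat_diag_def)
  show ?thesis
    unfolding unitary_diag_def * by (simp add: mat_algebra)
qed

lemma unitary_diag_minus:
  assumes U: "unitary_mat n U"
  shows "unitary_diag n U d - unitary_diag n U e = unitary_diag n U (\<lambda>i. d i - e i)"
proof -
  note [simp] = unitary_mat_dim[OF U]
  have *: "mat_diag n (\<lambda>i. complex_of_real (d i - e i)) = mat_diag n (\<lambda>i. complex_of_real (d i))
    - mat_diag n (\<lambda>i. complex_of_real (e i))"
    by (rule eq_matI) (auto simp: mat_diag_def)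
  show ?thesis
    unfolding unitary_diag_def * by (simp add: mat_algebra)
qed

lemma unitary_diag_ext:
  assumes "\<And>i. i < n \<Longrightarrow> d i = e i"
  shows "unitary_diag n U d = unitary_diag n U e"
proof -
  have "mat_diag n (\<lambda>i. complex_of_real (d i)) = mat_diag n (\<lambda>i. complex_of_real (e i))"
    by (rule eq_matI) (auto simp: mat_diag_def assms)
  then show ?thesis by (simp add: unitary_diag_def)
qed

lemma unitary_diag_one:
  assumes U: "unitary_mat n U"
  shows "unitary_diag n U (\<lambda>_. 1) = 1\<^sub>m n"
  using U unfolding unitary_diag_def unitary_mat_def by (auto simp: right_mult_one_mat[of U n n])

lemma unitary_diag_zero:
  assumes U: "unitary_mat n U"
  shows "unitary_diag n U (\<lambda>_. 0) = 0\<^sub>m n n"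
proof -
  have "mat_diag n (\<lambda>i. 0) = (0\<^sub>m n n :: complex mat)"
    by (rule eq_matI) (auto simp: mat_diag_def)
  then show ?thesis using unitary_mat_dim[OF U]
    by (auto simp: unitary_diag_def intro!: eq_matI)
qed

lemma psd_unitary_diag:
  assumes U: "unitary_mat n U" and d: "\<And>i. i < n \<Longrightarrow> 0 \<le> d i"
  shows "psd_mat n (unitary_diag n U d)"
proof -
  have "unitary_diag n U d = unitary_diag n U (\<lambda>i. sqrt (d i) * sqrt (d i))"
    using d by (intro unitary_diag_ext) simp
  also have "\<dots> = mat_adjoint (unitary_diag n U (\<lambda>i. sqrt (d i))) * unitary_diag n U (\<lambda>i. sqrt (d i))"
    by (simp add: unitary_diag_mult U hermitian_adjoint[OF hermitian_unitary_diag[OF U]])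
  finally show ?thesis
    using psd_adjoint_mult_self[OF unitary_diag_carrier[OF U]] by metis
qed

text \<open>Outside the indices below \<open>n\<close> the values of \<open>d\<close> are arbitrary; choosing them to be \<open>0\<close> makes
nonnegativity unconditional, which spares later arguments the index bound.\<close>

lemma psd_diagE:
  assumes "psd_mat n A"
  obtains U d where "unitary_mat n U" "A = unitary_diag n U d" "\<And>i. 0 \<le> d i"
proof -
  obtain U d where U: "unitary_mat n U" and A: "A = unitary_diag n U d"
    using hermitian_diagE[OF psd_imp_hermitian[OF assms]] .
  have u: "mat_adjoint U * U = 1\<^sub>m n" using U by (simp add: unitary_mat_def)
  note [simp] = unitary_mat_dim[OF U]
  define D where "D = mat_diag n (\<lambda>i. complex_of_real (d i))"
  have [simp]: "dim_row D = n" "dim_col D = n" by (auto simp: D_def)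
  have "psd_mat n (mat_adjoint U * A * U)"
    using psd_congruence[OF assms] U by (simp add: unitary_mat_def)
  also have "mat_adjoint U * A * U = D"
    unfolding A unitary_diag_def D_def[symmetric] by (simp add: mat_algebra u u[THEN mat_assoc_eq])
  finally have D: "psd_mat n D" .
  have d: "0 \<le> d i" if "i < n" for i
    using psd_diag_nonneg[OF D that] that by (simp add: D_def mat_diag_def less_eq_complex_def)
  show ?thesis
  proof
    show "A = unitary_diag n U (\<lambda>i. if i < n then d i else 0)"
      unfolding A by (rule unitary_diag_ext) simp
  qed (use U d in auto)
qed

lemma mat_fun_hermitian: "hermitian_mat n A \<Longrightarrow> hermitian_mat n (mat_fun f A)"
  by (metis hermitian_diagE mat_fun_unitary_diag hermitian_unitary_diag)

lemma mat_fun_mult: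
  "hermitian_mat n A \<Longrightarrow> mat_fun f A * mat_fun g A = mat_fun (\<lambda>x. f x * g x) A"
  by (erule hermitian_diagE) (simp add: mat_fun_unitary_diag unitary_diag_mult comp_def)

lemma mat_fun_add:
  "hermitian_mat n A \<Longrightarrow> mat_fun f A + mat_fun g A = mat_fun (\<lambda>x. f x + g x) A"
  by (erule hermitian_diagE) (simp add: mat_fun_unitary_diag unitary_diag_add comp_def)

lemma mat_fun_minus:
  "hermitian_mat n A \<Longrightarrow> mat_fun f A - mat_fun g A = mat_fun (\<lambda>x. f x - g x) A"
  by (erule hermitian_diagE) (simp add: mat_fun_unitary_diag unitary_diag_minus comp_def)

lemma mat_fun_one: "hermitian_mat n A \<Longrightarrow> mat_fun (\<lambda>x. 1) A = 1\<^sub>m n"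
  by (erule hermitian_diagE) (simp add: mat_fun_unitary_diag unitary_diag_one comp_def)

lemma mat_fun_zero: "hermitian_mat n A \<Longrightarrow> mat_fun (\<lambda>x. 0) A = 0\<^sub>m n n"
  by (erule hermitian_diagE) (simp add: mat_fun_unitary_diag unitary_diag_zero comp_def)

lemma mat_fun_ident: "hermitian_mat n A \<Longrightarrow> mat_fun (\<lambda>x. x) A = A"
  by (erule hermitian_diagE) (simp add: mat_fun_unitary_diag comp_def)

text \<open>Positive semi-definite matrices have nonnegative spectrum, so only arguments \<open>t \<ge> 0\<close> count. Together with
\<open>x / 0 = 0\<close> this lets \<open>\<lambda>t. t / f t\<close> stand for \<open>g\<close> everywhere.\<close>

lemma mat_fun_cong:
  assumes "psd_mat n A" "\<And>t. 0 \<le> t \<Longrightarrow> f t = g t"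
  shows "mat_fun f A = mat_fun g A"
  using assms(1)
  by (rule psd_diagE) (auto simp: mat_fun_unitary_diag assms(2) intro!: unitary_diag_ext)

lemma psd_mat_fun:
  assumes "psd_mat n A" "\<And>t. 0 \<le> t \<Longrightarrow> 0 \<le> f t"
  shows "psd_mat n (mat_fun f A)"
  using assms(1)
  by (rule psd_diagE) (auto simp: mat_fun_unitary_diag assms(2) intro!: psd_unitary_diag)

lemma mat_fun_mult3:
  assumes "hermitian_mat n A"
  shows "mat_fun f A * (mat_fun g A * mat_fun h A) = mat_fun (\<lambda>t. f t * (g t * h t)) A"
  by (simp add: mat_fun_mult[OF assms])

lemma mat_sqrt_square:
  assumes "psd_mat n A"
  shows "mat_sqrt A * mat_sqrt A = A"
proof -
  have "mat_sqrt A * mat_sqrt A = mat_fun (\<lambda>t. sqrt t * sqrt t) A"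
    unfolding mat_sqrt_def by (rule mat_fun_mult[OF psd_imp_hermitian[OF assms]])
  also have "\<dots> = mat_fun (\<lambda>t. t) A" by (rule mat_fun_cong[OF assms]) simp
  finally show ?thesis by (simp add: mat_fun_ident[OF psd_imp_hermitian[OF assms]])
qed

lemma psd_mat_sqrt: "psd_mat n A \<Longrightarrow> psd_mat n (mat_sqrt A)"
  unfolding mat_sqrt_def by (rule psd_mat_fun) simp_all

text \<open>In eigenbases of \<open>A\<close> and \<open>B\<close> the relation \<open>A X = X B\<close> says that an entry of \<open>X\<close> vanishes unless the two
eigenvalues agree, a condition that is inherited by \<open>f(A)\<close> and \<open>f(B)\<close>. It yields functional calculus on block matrices, on unitary conjugates, and on
\<open>T T\<^sup>*\<close> versus \<open>T\<^sup>* T\<close>.\<close>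

lemma mat_fun_intertwine:
  assumes A: "hermitian_mat n A" and B: "hermitian_mat m B" and X: "X \<in> carrier_mat n m" and eq: "A * X = X * B"
  shows "mat_fun f A * X = X * mat_fun f B"
proof -
  obtain U a where U: "unitary_mat n U" and Ad: "A = unitary_diag n U a" using A by (rule hermitian_diagE)
  obtain V b where V: "unitary_mat m V" and Bd: "B = unitary_diag m V b" using B by (rule hermitian_diagE)
  note [simp] = unitary_mat_dim[OF U] unitary_mat_dim[OF V] carrier_matD[OF X]
  have UV: "mat_adjoint U * U = 1\<^sub>m n" "U * mat_adjoint U = 1\<^sub>m n"
    "mat_adjoint V * V = 1\<^sub>m m" "V * mat_adjoint V = 1\<^sub>m m"
    using U V by (auto simp: unitary_mat_def)
  note UVc = UV[THEN mat_assoc_eq]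
  define D E where "D = (\<lambda>a :: nat \<Rightarrow> real. mat_diag n (\<lambda>i. complex_of_real (a i)))"
    and "E = (\<lambda>b :: nat \<Rightarrow> real. mat_diag m (\<lambda>i. complex_of_real (b i)))"
  have [simp]: "dim_row (D a) = n" "dim_col (D a) = n" "dim_row (E b) = m" "dim_col (E b) = m" for a b
    by (simp_all add: D_def E_def)
  have UD: "unitary_diag n U a = U * D a * mat_adjoint U" for a
    by (simp add: unitary_diag_def D_def)
  have VE: "unitary_diag m V b = V * E b * mat_adjoint V" for b
    by (simp add: unitary_diag_def E_def)
  define W where "W = mat_adjoint U * X * V"
  have W: "W \<in> carrier_mat n m" by (auto simp: W_def intro: carrier_matI)
  have X: "X = U * W * mat_adjoint V"
    by (simp add: W_def mat_algebra UVc) (simp add: UV)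
  have cross: "unitary_diag n U a * X = X * unitary_diag m V b \<longleftrightarrow> D a * W = W * E b" for a b
  proof
    assume "unitary_diag n U a * X = X * unitary_diag m V b"
    then have "mat_adjoint U * (unitary_diag n U a * X) * V = mat_adjoint U * (X * unitary_diag m V b) * V"
      by simp
    then show "D a * W = W * E b"
      unfolding UD VE by (simp add: W_def mat_algebra UVc) (simp add: UV)
  next
    assume h: "D a * W = W * E b"
    have [simp]: "dim_row W = n" "dim_col W = m" using W by auto
    show "unitary_diag n U a * X = X * unitary_diag m V b"
      unfolding UD VE X
      by (simp add: mat_algebra UVc h[THEN mat_assoc_eq])
  qed
  have entry: "D a * W = W * E b \<longleftrightarrow>
      (\<forall>i<n. \<forall>j<m. complex_of_real (a i) * W $$ (i, j) = W $$ (i, j) * complex_of_real (b j))" for a b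
    unfolding D_def E_def mat_diag_mult_left[OF W] mat_diag_mult_right[OF W]
    by (auto simp: mat_eq_iff)
  have E: "\<forall>i<n. \<forall>j<m. complex_of_real (a i) * W $$ (i, j) = W $$ (i, j) * complex_of_real (b j)"
    using eq unfolding Ad Bd cross entry .
  have "D (f \<circ> a) * W = W * E (f \<circ> b)"
    unfolding entry
  proof (intro allI impI)
    fix i j assume "i < n" "j < m"
    then have "W $$ (i, j) = 0 \<or> a i = b j" using E by auto
    then show "complex_of_real ((f \<circ> a) i) * W $$ (i, j) = W $$ (i, j) * complex_of_real ((f \<circ> b) j)"
      by auto
  qed
  then show ?thesis
    unfolding Ad Bd by (simp add: mat_fun_unitary_diag U V cross)
qed

lemma mat_fun_compress:
  assumes Y: "hermitian_mat m Y" and A: "hermitian_mat n A" and E: "E \<in> carrier_mat m n"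
    and iso: "mat_adjoint E * E = 1\<^sub>m n" and YE: "Y * E = E * A"
  shows "mat_adjoint E * (mat_fun f Y * E) = mat_fun f A"
  using mat_fun_intertwine[OF Y A E YE, of f] hermitian_dim[OF mat_fun_hermitian[OF A, of f]] E
  by (simp add: iso[THEN mat_assoc_eq])

section \<open>Operator monotonicity of a concave function\<close>

lemma matrix_concaveD:
  assumes "matrix_concave n f" "0 \<le> l" "l \<le> 1" "psd_mat n A" "psd_mat n B"
  shows "psd_mat n (mat_fun f (complex_of_real l \<cdot>\<^sub>m A + complex_of_real (1 - l) \<cdot>\<^sub>m B)
    - (complex_of_real l \<cdot>\<^sub>m mat_fun f A + complex_of_real (1 - l) \<cdot>\<^sub>m mat_fun f B))"
  using assms unfolding matrix_concave_def loewner_le_def by blast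

text \<open>Matrices of size \<open>n\<close> are padded by a zero first row and column, and the inequality is compressed back.\<close>

lemma matrix_concave_pred:
  assumes "matrix_concave (Suc n) f"
  shows "matrix_concave n f"
  unfolding matrix_concave_def loewner_le_def
proof (intro allI impI, elim conjE)
  fix l :: real and A B
  assume l: "0 \<le> l" "l \<le> 1" and A: "psd_mat n A" and B: "psd_mat n B"
  define E where "E = tail_incl n"
  have Ed [simp]: "dim_row E = Suc n" "dim_col E = n" by (simp_all add: E_def)
  have Ec: "E \<in> carrier_mat (Suc n) n" by (auto intro: carrier_matI)
  have iso: "mat_adjoint E * E = 1\<^sub>m n" by (simp add: E_def)
  define up where "up X = E * (X * mat_adjoint E)" for X
  define Z where "Z X Y = complex_of_real l \<cdot>\<^sub>m X + complex_of_real (1 - l) \<cdot>\<^sub>m Y" for X Y :: "complex mat"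
  note [simp] = psd_mat_dim[OF A] psd_mat_dim[OF B]
  have up: "psd_mat (Suc n) (up X)" if "psd_mat n X" for X
    using psd_congruence[OF that mat_adjoint_carrier[OF Ec]] psd_mat_dim[OF that]
    by (simp add: up_def mat_algebra)
  have upE: "up X * E = E * X" if "psd_mat n X" for X
    using psd_mat_dim[OF that] by (simp add: up_def mat_algebra iso)
  have down: "mat_adjoint E * (mat_fun f (up X) * E) = mat_fun f X" if "psd_mat n X" for X
    by (rule mat_fun_compress[OF _ _ Ec iso upE[OF that]]) (use up that psd_imp_hermitian in auto)
  have hZ: "hermitian_mat n (Z A B)" "hermitian_mat (Suc n) (Z (up A) (up B))"
    unfolding Z_def by (intro hermitian_add hermitian_smult psd_imp_hermitian up A B)+
  have ZE: "Z (up A) (up B) * E = E * Z A B"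
    using psd_mat_dim[OF up[OF A]] psd_mat_dim[OF up[OF B]]
    by (simp add: Z_def mat_algebra upE A B)
  have dims [simp]: "dim_row (mat_fun f X) = k" "dim_col (mat_fun f X) = k" if "psd_mat k X" for X k
    using hermitian_dim[OF mat_fun_hermitian[OF psd_imp_hermitian[OF that]]] by auto
  have dZ [simp]: "dim_row (mat_fun f (Z (up A) (up B))) = Suc n" "dim_col (mat_fun f (Z (up A) (up B))) = Suc n"
    using hermitian_dim[OF mat_fun_hermitian[OF hZ(2)]] by auto
  note [simp] = dims[OF up[OF A]] dims[OF up[OF B]]
  have "psd_mat (Suc n) (mat_fun f (Z (up A) (up B)) - Z (mat_fun f (up A)) (mat_fun f (up B)))"
    unfolding Z_def by (rule matrix_concaveD[OF assms l up[OF A] up[OF B]])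
  then have "psd_mat n (mat_adjoint E * (mat_fun f (Z (up A) (up B)) - Z (mat_fun f (up A)) (mat_fun f (up B))) * E)"
    using psd_congruence[OF _ Ec] by blast
  also have "mat_adjoint E * (mat_fun f (Z (up A) (up B)) - Z (mat_fun f (up A)) (mat_fun f (up B))) * E
    = mat_fun f (Z A B) - Z (mat_fun f A) (mat_fun f B)"
    unfolding down[OF A, symmetric] down[OF B, symmetric]
      mat_fun_compress[OF hZ(2,1) Ec iso ZE, symmetric]
    by (simp add: Z_def[of "mat_fun f (up A)"] Z_def[of "mat_adjoint E * _"] mat_algebra)
  finally show "psd_mat n (mat_fun f (complex_of_real l \<cdot>\<^sub>m A + complex_of_real (1 - l) \<cdot>\<^sub>m B)
    - (complex_of_real l \<cdot>\<^sub>m mat_fun f A + complex_of_real (1 - l) \<cdot>\<^sub>m mat_fun f B))"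
    by (simp add: Z_def)
qed

text \<open>The quadratic form of \<open>X - l Y\<close> is affine in \<open>l\<close>, so its nonnegativity passes to the limit \<open>l = 1\<close>.\<close>

lemma psd_minus_limit:
  assumes X: "hermitian_mat n X" and Y: "hermitian_mat n Y"
    and psd: "\<And>l. 0 \<le> l \<Longrightarrow> l < 1 \<Longrightarrow> psd_mat n (X - complex_of_real l \<cdot>\<^sub>m Y)"
  shows "psd_mat n (X - Y)"
proof -
  have c: "X \<in> carrier_mat n n" "Y \<in> carrier_mat n n" using X Y by (auto simp: hermitian_mat_def)
  have "0 \<le> ((X - Y) *\<^sub>v v) \<bullet>c v" if v: "v \<in> carrier_vec n" for v
  proof -
    define x y where "x = (X *\<^sub>v v) \<bullet>c v" and "y = (Y *\<^sub>v v) \<bullet>c v"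
    have quad: "((X - complex_of_real l \<cdot>\<^sub>m Y) *\<^sub>v v) \<bullet>c v = x - complex_of_real l * y" for l
      using c v by (simp add: x_def y_def minus_mult_distrib_mat_vec[of _ n n] smult_mat_mult_vec
          minus_scalar_prod_distrib[of _ n])
    have ge: "0 \<le> x - complex_of_real l * y" if "0 \<le> l" "l < 1" for l
      using psd[OF that] v unfolding quad[symmetric] psd_mat_def by blast
    have "Im x = 0" using ge[of 0] by (simp add: less_eq_complex_def)
    moreover have "Im y = 0" using ge[of "1/2"] \<open>Im x = 0\<close> by (simp add: less_eq_complex_def)
    moreover have "Re y \<le> Re x"
      by (rule field_le_mult_one_interval) (use ge in \<open>auto simp: less_eq_complex_def\<close>)
    moreover have "complex_of_real 1 \<cdot>\<^sub>m Y = Y" by (rule eq_matI) auto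
    ultimately show ?thesis using quad[of 1] by (simp add: less_eq_complex_def)
  qed
  then show ?thesis using X Y c unfolding psd_mat_def by (auto simp: mat_algebra hermitian_mat_def)
qed

text \<open>For \<open>l < 1\<close> the matrix \<open>D = (C - l A) / (1 - l)\<close> is positive semi-definite and
\<open>C = l A + (1 - l) D\<close>. Dropping the term \<open>(1 - l) f(D) \<ge> 0\<close> from the concavity inequality leaves
\<open>f(C) \<ge> l f(A)\<close>.\<close>

lemma mat_fun_mono:
  assumes conc: "matrix_concave n f" and nonneg: "\<And>t. 0 \<le> t \<Longrightarrow> 0 \<le> f t"
    and A: "psd_mat n A" and C: "psd_mat n C" and le: "psd_mat n (C - A)"
  shows "psd_mat n (mat_fun f C - mat_fun f A)"
proof (rule psd_minus_limit)
  fix l :: real assume l: "0 \<le> l" "l < 1"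
  define D where "D = complex_of_real (1 / (1 - l)) \<cdot>\<^sub>m ((C - A) + complex_of_real (1 - l) \<cdot>\<^sub>m A)"
  have D: "psd_mat n D" unfolding D_def using l by (intro psd_smult psd_add le A) auto
  note [simp] = psd_mat_dim[OF A] psd_mat_dim[OF C]
  have dims [simp]: "dim_row (mat_fun f X) = n" "dim_col (mat_fun f X) = n" if "psd_mat n X" for X
    using hermitian_dim[OF mat_fun_hermitian[OF psd_imp_hermitian[OF that]]] by auto
  have "complex_of_real l \<cdot>\<^sub>m A + complex_of_real (1 - l) \<cdot>\<^sub>m D = C"
  proof (rule eq_matI)
    fix i j assume "i < dim_row C" "j < dim_col C"
    moreover have "1 - complex_of_real l \<noteq> 0" using l by (simp add: complex_eq_iff)
    ultimately show "(complex_of_real l \<cdot>\<^sub>m A + complex_of_real (1 - l) \<cdot>\<^sub>m D) $$ (i, j) = C $$ (i, j)"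
      by (simp add: D_def field_simps)
  qed (simp_all add: D_def)
  then have "psd_mat n (mat_fun f C - (complex_of_real l \<cdot>\<^sub>m mat_fun f A + complex_of_real (1 - l) \<cdot>\<^sub>m mat_fun f D))"
    using matrix_concaveD[OF conc l(1) less_imp_le[OF l(2)] A D] by simp
  moreover have "psd_mat n (complex_of_real (1 - l) \<cdot>\<^sub>m mat_fun f D)"
    using l by (intro psd_smult psd_mat_fun[OF D] nonneg) auto
  ultimately have "psd_mat n ((mat_fun f C - (complex_of_real l \<cdot>\<^sub>m mat_fun f A + complex_of_real (1 - l) \<cdot>\<^sub>m mat_fun f D))
     + complex_of_real (1 - l) \<cdot>\<^sub>m mat_fun f D)"
    by (rule psd_add)
  also have "(mat_fun f C - (complex_of_real l \<cdot>\<^sub>m mat_fun f A + complex_of_real (1 - l) \<cdot>\<^sub>m mat_fun f D))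
     + complex_of_real (1 - l) \<cdot>\<^sub>m mat_fun f D = mat_fun f C - complex_of_real l \<cdot>\<^sub>m mat_fun f A"
    by (rule eq_matI) (auto simp: A C D)
  finally show "psd_mat n (mat_fun f C - complex_of_real l \<cdot>\<^sub>m mat_fun f A)" .
qed (use A C psd_imp_hermitian mat_fun_hermitian in blast)+

section \<open>Operator monotonicity of the quotient\<close>

text \<open>For invertible \<open>A\<close> this says that \<open>f(t) / t\<close> decreases under the rank one increment \<open>v v\<^sup>*\<close>. The two matrices
\<open>B = T T\<^sup>*\<close> and \<open>Y = T\<^sup>* T\<close> share their nonzero spectrum, and \<open>T\<close> needs only one column more than \<open>A\<close>
because the increment has rank one.\<close>

lemma mat_fun_rank_one_compression:
  assumes conc: "matrix_concave (Suc n) f" and f0: "0 \<le> f 0"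
    and A: "psd_mat n A" and v: "v \<in> carrier_mat n 1"
  defines "S \<equiv> mat_sqrt A" and "H \<equiv> mat_fun (\<lambda>t. f t / t) (A + v * mat_adjoint v)"
  shows "psd_mat n (mat_fun f A - S * H * S)"
proof -
  note [simp] = psd_mat_dim[OF A] carrier_matD[OF v]
  note hA = psd_imp_hermitian[OF A]
  have S: "psd_mat n S" unfolding S_def by (rule psd_mat_sqrt[OF A])
  note [simp] = psd_mat_dim[OF S] hermitian_adjoint[OF psd_imp_hermitian[OF S]]
  have SS: "S * S = A" unfolding S_def by (rule mat_sqrt_square[OF A])
  define B where "B = A + v * mat_adjoint v"
  have B: "psd_mat n B"
    unfolding B_def using psd_adjoint_mult_self[OF mat_adjoint_carrier[OF v]] psd_add[OF A] by simp
  have hH: "hermitian_mat n H" unfolding H_def B_def[symmetric] by (rule mat_fun_hermitian[OF psd_imp_hermitian[OF B]])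
  note [simp] = psd_mat_dim[OF B] hermitian_dim[OF hH]
  define E e where "E = tail_incl n" and "e = head_incl n"
  have Ed [simp]: "dim_row E = Suc n" "dim_col E = n" "dim_row e = Suc n" "dim_col e = 1"
    by (simp_all add: E_def e_def)
  have Ec: "E \<in> carrier_mat (Suc n) n" by (auto intro: carrier_matI)
  note iso = incl_isometry[of n, folded E_def e_def]
  note isoc = iso[THEN mat_assoc_eq]
  define T where "T = S * mat_adjoint E + v * mat_adjoint e"
  have [simp]: "dim_row T = n" "dim_col T = Suc n" by (simp_all add: T_def)
  have T: "T \<in> carrier_mat n (Suc n)" by (auto intro: carrier_matI)
  have TE: "T * E = S" by (simp add: T_def mat_algebra iso)
  have TT: "T * mat_adjoint T = B"
    by (simp add: T_def B_def mat_algebra isoc SS)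
  define Y where "Y = mat_adjoint T * T"
  have Y: "psd_mat (Suc n) Y" unfolding Y_def by (rule psd_adjoint_mult_self[OF T])
  note hY = psd_imp_hermitian[OF Y]
  \<comment> \<open>The reflection \<open>V\<close> flips the sign of the off-diagonal blocks of \<open>Y\<close>, so the mean \<open>Z\<close> of \<open>Y\<close> and
  \<open>V Y V\<close> is block diagonal with \<open>A\<close> as one block.\<close>
  define V where "V = E * mat_adjoint E - e * mat_adjoint e"
  have Vd [simp]: "dim_row V = Suc n" "dim_col V = Suc n" by (simp_all add: V_def)
  have Vc: "V \<in> carrier_mat (Suc n) (Suc n)" by (auto intro: carrier_matI)
  have Va: "mat_adjoint V = V" by (simp add: V_def mat_algebra)
  have VE: "V * E = E" by (simp add: V_def mat_algebra iso) (auto intro!: eq_matI)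
  have EV: "mat_adjoint E * V = mat_adjoint E" using arg_cong[OF VE, of mat_adjoint] by (simp add: mat_algebra Va)
  have VV: "V * V = 1\<^sub>m (Suc n)"
  proof -
    have "V * V = E * mat_adjoint E + e * mat_adjoint e"
      by (simp add: V_def mat_algebra isoc) (auto intro!: eq_matI)
    then show ?thesis using incl_complete by (simp add: E_def e_def)
  qed
  define Y' where "Y' = V * Y * V"
  have Y': "psd_mat (Suc n) Y'" using psd_congruence[OF Y Vc] by (simp add: Y'_def Va)
  note hY' = psd_imp_hermitian[OF Y']
  note [simp] = psd_mat_dim[OF Y] psd_mat_dim[OF Y'] hermitian_dim[OF mat_fun_hermitian[OF hY]]
    hermitian_dim[OF mat_fun_hermitian[OF hY']]
  have fY': "mat_adjoint E * (mat_fun f Y' * E) = mat_adjoint E * (mat_fun f Y * E)"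
  proof -
    have "Y' * V = V * Y" by (simp add: Y'_def mat_algebra VV)
    from mat_fun_intertwine[OF hY' hY Vc this] have "mat_fun f Y' * V = V * mat_fun f Y" .
    from this[THEN mat_assoc_eq, of E] show ?thesis
      by (simp add: VE mat_algebra EV[THEN mat_assoc_eq])
  qed
  define Z where "Z = complex_of_real (1/2) \<cdot>\<^sub>m Y + complex_of_real (1 - 1/2) \<cdot>\<^sub>m Y'"
  have hZ: "hermitian_mat (Suc n) Z" unfolding Z_def by (intro hermitian_add hermitian_smult hY hY')
  have ZE: "Z * E = E * A"
  proof -
    have "Y * E = mat_adjoint T * S" by (simp add: Y_def mat_algebra TE)
    then have YE: "Y * E = E * A + e * (mat_adjoint v * S)" by (simp add: T_def mat_algebra SS)
    have "Y' * E = V * (Y * E)" by (simp add: Y'_def mat_algebra VE)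
    also have "\<dots> = E * A - e * (mat_adjoint v * S)"
      unfolding YE by (simp add: V_def mat_algebra isoc) (auto intro!: eq_matI)
    finally have Y'E: "Y' * E = E * A - e * (mat_adjoint v * S)" .
    show ?thesis
      by (simp add: Z_def mat_algebra YE Y'E) (auto intro!: eq_matI simp: field_simps)
  qed
  note [simp] = hermitian_dim[OF mat_fun_hermitian[OF hZ]] hermitian_dim[OF mat_fun_hermitian[OF hA]]
  have "psd_mat (Suc n) (mat_fun f Z - (complex_of_real (1/2) \<cdot>\<^sub>m mat_fun f Y + complex_of_real (1 - 1/2) \<cdot>\<^sub>m mat_fun f Y'))"
    unfolding Z_def by (rule matrix_concaveD[OF conc _ _ Y Y']) auto
  from psd_congruence[OF this Ec]
  have "psd_mat n (mat_fun f A - (complex_of_real (1/2) \<cdot>\<^sub>m (mat_adjoint E * (mat_fun f Y * E))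
     + complex_of_real (1 - 1/2) \<cdot>\<^sub>m (mat_adjoint E * (mat_fun f Y * E))))"
    by (simp add: mat_algebra fY' mat_fun_compress[OF hZ hA Ec iso(1) ZE])
  also have "mat_fun f A - (complex_of_real (1/2) \<cdot>\<^sub>m (mat_adjoint E * (mat_fun f Y * E))
     + complex_of_real (1 - 1/2) \<cdot>\<^sub>m (mat_adjoint E * (mat_fun f Y * E)))
    = mat_fun f A - mat_adjoint E * (mat_fun f Y * E)"
    by (rule eq_matI) (auto simp: field_simps)
  finally have 1: "psd_mat n (mat_fun f A - mat_adjoint E * (mat_fun f Y * E))" .
  \<comment> \<open>The function \<open>t * (f t / t)\<close> agrees with \<open>f\<close> except that it vanishes at \<open>0\<close>; here \<open>f 0 \<ge> 0\<close> enters.\<close>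
  have "psd_mat (Suc n) (mat_fun (\<lambda>t. f t - t * (f t / t)) Y)"
    by (rule psd_mat_fun[OF Y]) (auto simp: f0)
  also have "mat_fun (\<lambda>t. f t - t * (f t / t)) Y = mat_fun f Y - mat_adjoint T * (H * T)"
  proof -
    have "B * T = T * Y" by (simp add: Y_def mat_algebra TT[symmetric])
    from mat_fun_intertwine[OF psd_imp_hermitian[OF B] hY T this]
    have "H * T = T * mat_fun (\<lambda>t. f t / t) Y" by (simp add: H_def B_def)
    then have "mat_adjoint T * (H * T) = mat_adjoint T * (T * mat_fun (\<lambda>t. f t / t) Y)"
      by simp
    also have "\<dots> = Y * mat_fun (\<lambda>t. f t / t) Y"
      by (subst mat_assoc[symmetric]) (simp_all flip: Y_def)
    also have "\<dots> = mat_fun (\<lambda>t. t) Y * mat_fun (\<lambda>t. f t / t) Y"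
      by (simp add: mat_fun_ident[OF hY])
    also have "\<dots> = mat_fun (\<lambda>t. t * (f t / t)) Y"
      by (rule mat_fun_mult[OF hY])
    finally show ?thesis by (simp only: mat_fun_minus[OF hY])
  qed
  finally have "psd_mat n (mat_adjoint E * (mat_fun f Y - mat_adjoint T * (H * T)) * E)"
    by (rule psd_congruence[OF _ Ec])
  also have "mat_adjoint E * (mat_fun f Y - mat_adjoint T * (H * T)) * E
    = mat_adjoint E * (mat_fun f Y * E) - S * H * S"
  proof -
    have ET: "mat_adjoint E * mat_adjoint T = S"
      using arg_cong[OF TE, of mat_adjoint] by (simp add: mat_algebra)
    show ?thesis by (simp add: mat_algebra TE ET[THEN mat_assoc_eq])
  qed
  finally have "psd_mat n (mat_adjoint E * (mat_fun f Y * E) - S * H * S)" .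
  with 1 have "psd_mat n ((mat_fun f A - mat_adjoint E * (mat_fun f Y * E))
     + (mat_adjoint E * (mat_fun f Y * E) - S * H * S))" by (rule psd_add)
  also have "(mat_fun f A - mat_adjoint E * (mat_fun f Y * E))
     + (mat_adjoint E * (mat_fun f Y * E) - S * H * S) = mat_fun f A - S * H * S"
    by (rule eq_matI) auto
  finally show ?thesis .
qed

text \<open>Write \<open>G = g(A)\<close>, \<open>K = g(B)\<close> and \<open>H = h(B)\<close> with \<open>h(t) = f(t) / t\<close>. The compression inequality, multiplied
on both sides by \<open>R\<close> with \<open>R A\<^sup>1\<^sup>/\<^sup>2 = G\<close> and \<open>R f(A) R = G\<close>, reads \<open>G H G \<le> G\<close>. Because \<open>K\<close> is the
pseudo-inverse of \<open>H\<close> and the range of \<open>G\<close> lies in that of \<open>B\<close>,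
\<open>K - G = (K - G) H (K - G) + (G - G H G)\<close>, a sum of two positive semi-definite matrices.\<close>

lemma mat_fun_rank_one_mono:
  assumes conc: "matrix_concave (Suc n) f" and f0: "0 \<le> f 0" and fpos: "\<And>t. 0 < t \<Longrightarrow> 0 < f t"
    and A: "psd_mat n A" and v: "v \<in> carrier_mat n 1"
  shows "psd_mat n (mat_fun (\<lambda>t. t / f t) (A + v * mat_adjoint v) - mat_fun (\<lambda>t. t / f t) A)"
proof -
  define B where "B = A + v * mat_adjoint v"
  define S where "S = mat_sqrt A"
  define R where "R = mat_fun (\<lambda>t. sqrt t / f t) A"
  define G where "G = mat_fun (\<lambda>t. t / f t) A"
  define H where "H = mat_fun (\<lambda>t. f t / t) B"
  define K where "K = mat_fun (\<lambda>t. t / f t) B"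
  \<comment> \<open>\<open>N\<close> and \<open>P\<close> are the orthogonal projections onto the kernel and onto the range of \<open>B\<close>.\<close>
  define N where "N = mat_fun (\<lambda>t. if t = 0 then 1 else 0) B"
  define P where "P = mat_fun (\<lambda>t. if t = 0 then 0 else 1) B"
  have fnn: "0 \<le> f t" if "0 \<le> t" for t using f0 fpos[of t] that by (cases "t = 0") auto
  have vv: "psd_mat n (v * mat_adjoint v)"
    using psd_adjoint_mult_self[OF mat_adjoint_carrier[OF v]] by simp
  have B: "psd_mat n B" unfolding B_def by (rule psd_add[OF A vv])
  note hA = psd_imp_hermitian[OF A] and hB = psd_imp_hermitian[OF B]
  have herms: "hermitian_mat n S" "hermitian_mat n R" "hermitian_mat n G" "hermitian_mat n H" "hermitian_mat n K" "hermitian_mat n N" "hermitian_mat n P"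
    unfolding S_def mat_sqrt_def R_def G_def H_def K_def N_def P_def by (intro mat_fun_hermitian hA hB)+
  note [simp] = herms[THEN hermitian_dim(1)] herms[THEN hermitian_dim(2)] herms[THEN hermitian_adjoint]
    psd_mat_dim[OF A] psd_mat_dim[OF B] carrier_matD[OF v]
  note [simp] = hermitian_dim[OF mat_fun_hermitian[OF hA]]
  have RS: "R * S = G"
  proof -
    have "R * S = mat_fun (\<lambda>t. sqrt t / f t * sqrt t) A"
      unfolding R_def S_def mat_sqrt_def by (rule mat_fun_mult[OF hA])
    also have "\<dots> = G" unfolding G_def by (rule mat_fun_cong[OF A]) (simp add: field_simps)
    finally show ?thesis .
  qed
  have SR: "S * R = G" using arg_cong[OF RS, of mat_adjoint] by (simp add: mat_adjoint_mult)
  have RfR: "R * (mat_fun f A * R) = G"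
  proof -
    have "R * (mat_fun f A * R) = mat_fun (\<lambda>t. sqrt t / f t * (f t * (sqrt t / f t))) A"
      unfolding R_def by (rule mat_fun_mult3[OF hA])
    also have "\<dots> = G" unfolding G_def
    proof (rule mat_fun_cong[OF A])
      fix t :: real assume "0 \<le> t"
      then show "sqrt t / f t * (f t * (sqrt t / f t)) = t / f t"
        using fpos[of t] by (cases "t = 0") (auto simp: field_simps)
    qed
    finally show ?thesis .
  qed
  have "psd_mat n (mat_fun f A - S * H * S)"
    unfolding S_def H_def B_def by (rule mat_fun_rank_one_compression[OF conc f0 A v])
  then have "psd_mat n (mat_adjoint R * (mat_fun f A - S * H * S) * R)"
    by (rule psd_congruence) (auto intro: carrier_matI)
  also have "mat_adjoint R * (mat_fun f A - S * H * S) * R = G - G * (H * G)"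
    by (simp add: mat_algebra RfR SR RS[THEN mat_assoc_eq])
  finally have 1: "psd_mat n (G - G * (H * G))" .
  have KHK: "K * (H * K) = K"
  proof -
    have "K * (H * K) = mat_fun (\<lambda>t. t / f t * (f t / t * (t / f t))) B"
      unfolding K_def H_def by (rule mat_fun_mult3[OF hB])
    also have "\<dots> = K" unfolding K_def
    proof (rule mat_fun_cong[OF B])
      fix t :: real assume "0 \<le> t"
      then show "t / f t * (f t / t * (t / f t)) = t / f t"
        using fpos[of t] by (cases "t = 0") auto
    qed
    finally show ?thesis .
  qed
  have HK: "H * K = P"
  proof -
    have "H * K = mat_fun (\<lambda>t. f t / t * (t / f t)) B"
      unfolding K_def H_def by (rule mat_fun_mult[OF hB])
    also have "\<dots> = P" unfolding P_def
    proof (rule mat_fun_cong[OF B])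
      fix t :: real assume "0 \<le> t"
      then show "f t / t * (t / f t) = (if t = 0 then 0 else 1)"
        using fpos[of t] by (cases "t = 0") auto
    qed
    finally show ?thesis .
  qed
  have KH: "K * H = P" using arg_cong[OF HK, of mat_adjoint] by (simp add: mat_adjoint_mult)
  have PN: "P + N = 1\<^sub>m n"
  proof -
    have "P + N = mat_fun (\<lambda>t. (if t = 0 then 0 else 1) + (if t = 0 then 1 else 0)) B"
      unfolding P_def N_def by (rule mat_fun_add[OF hB])
    also have "\<dots> = mat_fun (\<lambda>t. 1) B" by (rule mat_fun_cong[OF B]) simp
    finally show ?thesis by (simp add: mat_fun_one[OF hB])
  qed
  have NBN: "N * (B * N) = 0\<^sub>m n n"
  proof -
    have "N * (B * N) = N * (mat_fun (\<lambda>t. t) B * N)" by (simp add: mat_fun_ident[OF hB])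
    also have "\<dots> = mat_fun (\<lambda>t. (if t = 0 then 1 else 0) * (t * (if t = 0 then 1 else 0))) B"
      unfolding N_def by (rule mat_fun_mult3[OF hB])
    also have "\<dots> = mat_fun (\<lambda>t. 0) B" by (rule mat_fun_cong[OF B]) simp
    finally show ?thesis by (simp add: mat_fun_zero[OF hB])
  qed
  \<comment> \<open>Since \<open>0 \<le> N A N \<le> N B N = 0\<close>, the kernel of \<open>B\<close> is contained in that of \<open>A\<close>.\<close>
  have SN: "S * N = 0\<^sub>m n n"
  proof (rule adjoint_mult_self_eq_0)
    have N: "N \<in> carrier_mat n n" by (auto intro: carrier_matI)
    have 1: "mat_adjoint (S * N) * (S * N) = mat_adjoint N * A * N"
      using mat_sqrt_square[OF A, THEN mat_assoc_eq, of N] by (simp add: mat_algebra flip: S_def)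
    have 2: "mat_adjoint N * A * N + mat_adjoint N * (v * mat_adjoint v) * N = 0\<^sub>m n n"
      using NBN by (simp add: B_def mat_algebra)
    fix i assume i: "i < n"
    have "0 \<le> (mat_adjoint N * A * N) $$ (i, i)"
      "0 \<le> (mat_adjoint N * (v * mat_adjoint v) * N) $$ (i, i)"
      using psd_diag_nonneg[OF psd_congruence[OF A N] i] psd_diag_nonneg[OF psd_congruence[OF vv N] i] .
    moreover have "(mat_adjoint N * A * N) $$ (i, i) + (mat_adjoint N * (v * mat_adjoint v) * N) $$ (i, i) = 0"
      using arg_cong[OF 2, of "\<lambda>M. M $$ (i, i)"] i by (simp del: index_mult_mat(1))
    ultimately show "(mat_adjoint (S * N) * (S * N)) $$ (i, i) = 0"
      unfolding 1 by (simp add: add_nonneg_eq_0_iff)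
  qed (auto intro: carrier_matI)
  have GP: "G * P = G"
  proof -
    have "G = G * (P + N)" unfolding PN by simp
    also have "\<dots> = G * P" by (simp add: mat_algebra RS[symmetric] SN)
    finally show ?thesis by simp
  qed
  have PG: "P * G = G" using arg_cong[OF GP, of mat_adjoint] by (simp add: mat_adjoint_mult)
  have "psd_mat n H" unfolding H_def by (rule psd_mat_fun[OF B]) (simp add: fnn)
  then have "psd_mat n (mat_adjoint (K - G) * H * (K - G))"
    by (rule psd_congruence) (auto intro: carrier_matI)
  from psd_add[OF this 1] have "psd_mat n (mat_adjoint (K - G) * H * (K - G) + (G - G * (H * G)))" .
  also have "mat_adjoint (K - G) * H * (K - G) + (G - G * (H * G)) = K - G"
    by (simp add: mat_algebra HK KHK[unfolded HK] GP KH[THEN mat_assoc_eq] PG) (auto intro!: eq_matI)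
  finally show ?thesis unfolding K_def G_def B_def .
qed

text \<open>Diagonalizing \<open>C - A\<close> and adding its eigenvalues one after the other reaches \<open>C\<close> from \<open>A\<close> in \<open>n\<close> steps of
rank at most one.\<close>

lemma mat_fun_quotient_mono:
  assumes conc: "matrix_concave (Suc n) f" and f0: "0 \<le> f 0" and fpos: "\<And>t. 0 < t \<Longrightarrow> 0 < f t"
    and A: "psd_mat n A" and C: "psd_mat n C" and le: "psd_mat n (C - A)"
  shows "psd_mat n (mat_fun (\<lambda>t. t / f t) C - mat_fun (\<lambda>t. t / f t) A)"
proof -
  obtain U d where U: "unitary_mat n U" and Q: "C - A = unitary_diag n U d" and d: "\<And>i. 0 \<le> d i"
    using psd_diagE[OF le] by blast
  note [simp] = psd_mat_dim[OF A] psd_mat_dim[OF C] unitary_mat_dim[OF U]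
  define X where "X k = A + unitary_diag n U (\<lambda>i. if i < k then d i else 0)" for k
  have X: "psd_mat n (X k)" for k
    unfolding X_def using d by (intro psd_add A psd_unitary_diag[OF U]) simp
  let ?g = "mat_fun (\<lambda>t. t / f t)"
  have dims [simp]: "dim_row (?g Y) = n" "dim_col (?g Y) = n" if "psd_mat n Y" for Y
    using hermitian_dim[OF mat_fun_hermitian[OF psd_imp_hermitian[OF that]]] by auto
  have step: "psd_mat n (?g (X (Suc k)) - ?g (X k))" for k
  proof -
    define u where "u = mat n 1 (\<lambda>(i, _). if i = k then complex_of_real (sqrt (d k)) else 0)"
    have [simp]: "dim_row u = n" "dim_col u = 1" by (simp_all add: u_def)
    have u: "u * mat_adjoint u = mat_diag n (\<lambda>i. complex_of_real (if i = k then d k else 0))"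
      by (rule eq_matI) (auto simp: u_def scalar_prod_def mat_diag_def d simp flip: of_real_mult)
    have "unitary_diag n U (\<lambda>i. if i < Suc k then d i else 0)
        = unitary_diag n U (\<lambda>i. (if i < k then d i else 0) + (if i = k then d k else 0))"
      by (rule unitary_diag_ext) auto
    also have "\<dots> = unitary_diag n U (\<lambda>i. if i < k then d i else 0)
        + unitary_diag n U (\<lambda>i. if i = k then d k else 0)"
      by (rule unitary_diag_add[OF U, symmetric])
    also have "unitary_diag n U (\<lambda>i. if i = k then d k else 0) = (U * u) * mat_adjoint (U * u)"
      unfolding unitary_diag_def u[symmetric] by (simp add: mat_algebra)
    finally have "X (Suc k) = X k + (U * u) * mat_adjoint (U * u)"
      unfolding X_def
      by (subst assoc_add_mat[of _ n n]) (auto intro: carrier_matI unitary_diag_carrier[OF U])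
    moreover have "U * u \<in> carrier_mat n 1" by (rule carrier_matI) simp_all
    ultimately show ?thesis
      using mat_fun_rank_one_mono[OF conc f0 fpos X] by simp
  qed
  have "psd_mat n (?g (X k) - ?g (X 0))" for k
  proof (induction k)
    case 0
    have "?g (X 0) - ?g (X 0) = mat_fun (\<lambda>_. 0) (X 0)"
      using mat_fun_minus[OF psd_imp_hermitian[OF X]] by simp
    then show ?case using psd_mat_fun[OF X] by simp
  next
    case (Suc k)
    have "?g (X (Suc k)) - ?g (X 0) = (?g (X (Suc k)) - ?g (X k)) + (?g (X k) - ?g (X 0))"
      by (rule eq_matI) (auto simp: X)
    then show ?case using psd_add[OF step[of k] Suc.IH] by simp
  qed
  moreover have "X 0 = A" by (simp add: X_def unitary_diag_zero[OF U])
  moreover have "X n = C"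
  proof -
    have "X n = A + (C - A)" unfolding X_def Q by (intro arg_cong2[of _ _ _ _ "(+)"] unitary_diag_ext) auto
    also have "\<dots> = C" by (rule eq_matI) auto
    finally show ?thesis .
  qed
  ultimately show ?thesis by metis
qed

section \<open>Traces and the generalized Powers-Stormer inequality\<close>

lemma mat_trace_add: "dim_row A = dim_row B \<Longrightarrow> dim_col B = dim_row B \<Longrightarrow> mat_trace (A + B) = mat_trace A + mat_trace B"
  by (simp add: mat_trace_def sum.distrib)

lemma mat_trace_minus: "dim_row A = dim_row B \<Longrightarrow> dim_col B = dim_row B \<Longrightarrow> mat_trace (A - B) = mat_trace A - mat_trace B"
  by (simp add: mat_trace_def sum_subtractf)

lemma mat_trace_mult_commute:
  assumes "dim_col A = dim_row B" "dim_col B = dim_row A"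
  shows "mat_trace (A * B) = mat_trace (B * A)"
proof -
  have "mat_trace (A * B) = (\<Sum>i<dim_row A. \<Sum>j<dim_row B. A $$ (i, j) * B $$ (j, i))"
    using assms by (simp add: mat_trace_def scalar_prod_def atLeast0LessThan)
  also have "\<dots> = (\<Sum>j<dim_row B. \<Sum>i<dim_row A. B $$ (j, i) * A $$ (i, j))"
    by (subst sum.swap) (simp add: mult.commute)
  also have "\<dots> = mat_trace (B * A)"
    using assms by (simp add: mat_trace_def scalar_prod_def atLeast0LessThan)
  finally show ?thesis .
qed

lemma mat_trace_psd_nonneg: "psd_mat n A \<Longrightarrow> 0 \<le> mat_trace A"
  unfolding mat_trace_def by (intro sum_nonneg) (auto simp: psd_mat_dim psd_diag_nonneg)

lemma mat_trace_sqrt_conj: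
  assumes X: "psd_mat n X" and Y: "Y \<in> carrier_mat n n"
  shows "mat_trace (mat_sqrt X * Y * mat_sqrt X) = mat_trace (X * Y)"
proof -
  note [simp] = psd_mat_dim[OF psd_mat_sqrt[OF X]] carrier_matD[OF Y]
  have "mat_trace (mat_sqrt X * Y * mat_sqrt X) = mat_trace (mat_sqrt X * (mat_sqrt X * Y))"
    by (rule mat_trace_mult_commute) simp_all
  also have "mat_sqrt X * (mat_sqrt X * Y) = X * Y"
    by (rule mat_assoc_eq) (simp_all add: mat_sqrt_square[OF X])
  finally show ?thesis .
qed

text \<open>\<open>X Y\<close> need not be self-adjoint, but it has the same trace as \<open>X\<^sup>1\<^sup>/\<^sup>2 Y X\<^sup>1\<^sup>/\<^sup>2 \<ge> 0\<close>.\<close>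

lemma mat_trace_mult_psd_nonneg:
  assumes X: "psd_mat n X" and Y: "psd_mat n Y"
  shows "0 \<le> mat_trace (X * Y)"
proof -
  note S = psd_mat_sqrt[OF X]
  have "psd_mat n (mat_adjoint (mat_sqrt X) * Y * mat_sqrt X)"
    using psd_congruence[OF Y, of "mat_sqrt X" n] S by (simp add: psd_mat_def)
  then have "0 \<le> mat_trace (mat_sqrt X * Y * mat_sqrt X)"
    unfolding hermitian_adjoint[OF psd_imp_hermitian[OF S]] by (rule mat_trace_psd_nonneg)
  then show ?thesis
    using mat_trace_sqrt_conj[OF X, of Y] Y by (simp add: psd_mat_def)
qed

text \<open>\<open>Q\<close> is the negative part of \<open>D\<close>, hence \<open>D + Q\<close> is the positive part, and \<open>|D|\<close> is the sum of the two.\<close>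

lemma jordan_decomposition:
  assumes D: "hermitian_mat n D"
  obtains Q where "psd_mat n Q" "psd_mat n (D + Q)" "mat_abs D = D + Q + Q"
proof -
  obtain U d where U: "unitary_mat n U" and Dd: "D = unitary_diag n U d" using D by (rule hermitian_diagE)
  define Q where "Q = unitary_diag n U (\<lambda>i. max (- d i) 0)"
  have sum: "D + Q = unitary_diag n U (\<lambda>i. d i + max (- d i) 0)"
    unfolding Dd Q_def by (rule unitary_diag_add[OF U])
  have "mat_abs D = mat_sqrt (unitary_diag n U (\<lambda>i. d i * d i))"
    unfolding mat_abs_def hermitian_adjoint[OF D] by (simp add: Dd unitary_diag_mult[OF U])
  also have "\<dots> = unitary_diag n U (\<lambda>i. \<bar>d i\<bar>)"
    by (simp add: mat_sqrt_def mat_fun_unitary_diag[OF U] comp_def)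
  also have "\<dots> = unitary_diag n U (\<lambda>i. d i + max (- d i) 0 + max (- d i) 0)"
    by (rule unitary_diag_ext) auto
  also have "\<dots> = D + Q + Q" unfolding sum unfolding Q_def by (rule unitary_diag_add[OF U, symmetric])
  finally have "mat_abs D = D + Q + Q" .
  moreover have "psd_mat n Q" unfolding Q_def by (rule psd_unitary_diag[OF U]) simp
  moreover have "psd_mat n (D + Q)" unfolding sum by (rule psd_unitary_diag[OF U]) simp
  ultimately show ?thesis using that by blast
qed

theorem theorem3p1:
  fixes n :: nat and f g :: "real \<Rightarrow> real" and A B :: "complex mat"
  assumes "matrix_concave (n + 1) f"
    and "f 0 \<ge> 0"
    and "f ` {0<..} \<subseteq> {0<..}"
    and "\<And>t. t > 0 \<Longrightarrow> g t = t / f t"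
    and "g 0 = 0"
    and "psd_mat n A" and "psd_mat n B"
  shows "mat_trace A + mat_trace B - mat_trace (mat_abs (A - B))
    \<le> 2 * mat_trace (mat_sqrt (mat_fun f A) * mat_fun g B * mat_sqrt (mat_fun f A))"
proof -
  note A = assms(6) and B = assms(7)
  have conc: "matrix_concave (Suc n) f" using assms(1) by simp
  have fpos: "0 < f t" if "0 < t" for t using assms(3) that by auto
  have fnn: "0 \<le> f t" if "0 \<le> t" for t using assms(2) fpos[of t] that by (cases "t = 0") auto
  have gnn: "0 \<le> g t" if "0 \<le> t" for t using assms(4,5) fnn that by (cases "t = 0") auto
  have g: "mat_fun g X = mat_fun (\<lambda>t. t / f t) X" if "psd_mat n X" for X
    using that by (rule mat_fun_cong) (use assms(4,5) in \<open>metis div_0 less_eq_real_def\<close>)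
  have fmono: "psd_mat n (mat_fun f Y - mat_fun f X)"
    and gmono: "psd_mat n (mat_fun g Y - mat_fun g X)"
    if "psd_mat n X" "psd_mat n Y" "psd_mat n (Y - X)" for X Y
    using mat_fun_mono[OF matrix_concave_pred[OF conc] fnn that]
      mat_fun_quotient_mono[OF conc assms(2) fpos that] that by (auto simp: g)
  have fg: "mat_trace (mat_fun f X * mat_fun g X) = mat_trace X" if X: "psd_mat n X" for X
  proof -
    note h = psd_imp_hermitian[OF X]
    have "mat_fun f X * mat_fun g X = mat_fun (\<lambda>t. f t * g t) X" by (rule mat_fun_mult[OF h])
    also have "\<dots> = mat_fun (\<lambda>t. t) X"
    proof (rule mat_fun_cong[OF X])
      fix t :: real assume "0 \<le> t"
      then show "f t * g t = t" using fpos[of t] assms(4,5) by (cases "t = 0") auto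
    qed
    finally show ?thesis by (simp add: mat_fun_ident[OF h])
  qed
  have dims [simp]: "dim_row (mat_fun h X) = n" "dim_col (mat_fun h X) = n" if "psd_mat n X" for X h
    using hermitian_dim[OF mat_fun_hermitian[OF psd_imp_hermitian[OF that]]] by auto
  note [simp] = psd_mat_dim[OF A] psd_mat_dim[OF B]
  have "hermitian_mat n (A - B)" by (intro hermitian_minus psd_imp_hermitian A B)
  then obtain Q where Q: "psd_mat n Q" "psd_mat n (A - B + Q)" "mat_abs (A - B) = A - B + Q + Q"
    by (rule jordan_decomposition)
  note [simp] = psd_mat_dim[OF Q(1)]
  \<comment> \<open>\<open>C\<close> is also \<open>B\<close> plus the positive part of \<open>A - B\<close>, so it is a common upper bound of \<open>A\<close> and \<open>B\<close>.\<close>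
  define C where "C = A + Q"
  have C: "psd_mat n C" unfolding C_def by (rule psd_add[OF A Q(1)])
  note [simp] = psd_mat_dim[OF C] A B C
  have "C - A = Q" unfolding C_def by (rule eq_matI) auto
  then have AC: "psd_mat n (C - A)" using Q(1) by simp
  have "C - B = A - B + Q" unfolding C_def by (rule eq_matI) auto
  then have BC: "psd_mat n (C - B)" using Q(2) by simp
  have fp: "psd_mat n (mat_fun f A)" and gp: "psd_mat n (mat_fun g B)"
    using psd_mat_fun[OF A fnn] psd_mat_fun[OF B gnn] by auto
  have "0 \<le> mat_trace (mat_fun f A * (mat_fun g C - mat_fun g A))"
    "0 \<le> mat_trace ((mat_fun f C - mat_fun f A) * (mat_fun g C - mat_fun g B))"
    "0 \<le> mat_trace ((mat_fun f C - mat_fun f B) * mat_fun g B)"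
    by (rule mat_trace_mult_psd_nonneg[OF fp gmono[OF A C AC]]
      mat_trace_mult_psd_nonneg[OF fmono[OF A C AC] gmono[OF B C BC]]
      mat_trace_mult_psd_nonneg[OF fmono[OF B C BC] gp])+
  then have "0 \<le> mat_trace (mat_fun f A * (mat_fun g C - mat_fun g A))
    + mat_trace ((mat_fun f C - mat_fun f A) * (mat_fun g C - mat_fun g B))
    + mat_trace ((mat_fun f C - mat_fun f B) * mat_fun g B)"
    by (intro add_nonneg_nonneg)
  also have "\<dots> = mat_trace (mat_fun f A * mat_fun g B) - (mat_trace A + mat_trace B - mat_trace C)"
    by (simp add: mat_diff_left mat_diff_right mat_trace_minus fg)
  finally have main: "mat_trace A + mat_trace B - mat_trace C \<le> mat_trace (mat_fun f A * mat_fun g B)"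
    by simp
  have lhs: "mat_trace A + mat_trace B - mat_trace (mat_abs (A - B))
     = 2 * (mat_trace A + mat_trace B - mat_trace C)"
    by (simp add: Q(3) C_def mat_trace_add mat_trace_minus)
  have rhs: "mat_trace (mat_sqrt (mat_fun f A) * mat_fun g B * mat_sqrt (mat_fun f A))
     = mat_trace (mat_fun f A * mat_fun g B)"
    by (rule mat_trace_sqrt_conj[OF psd_mat_fun[OF A fnn]]) (auto intro: carrier_matI)
  show ?thesis unfolding lhs rhs using main by (simp add: less_eq_complex_def)
qed

end
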